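(* Any knot diagram with $C$ crossings that is ascending or descending from some base point can be transformed into the zero-crossing unknot diagram using at most $(7C+1)C$ Reidemeister moves.
   Context: An oriented knot diagram is ascending from a point $b$ (not a crossing) if, travelling along the knot from $b$ in the direction of the orientation, every crossing is first met along its under-strand and later along its over-strand; it is descending from $b$ if every crossing is first met along its over-strand. *)

theory Defs
  imports Main
begin

text \<open>
Combinatorial model of oriented knot diagrams (on the 2-sphere) via signed Gauss codes.
A letter (a, ov, pos) records a passage of the knot through crossing a, along the
over-strand iff ov, the crossing being positive iff pos. The Gauss word lists the
crossing passages in the order met when travelling along the oriented knot; it is read
cyclically (the position 0 corresponds to a base point just before it).
\<close>

type_synonym letter = "nat \<times> bool \<times> bool"
type_synonym gauss = "letter list"

definition lbl :: "letter \<Rightarrow> nat" where "lbl x = fst x"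
definition is_over :: "letter \<Rightarrow> bool" where "is_over x = fst (snd x)"
definition is_pos :: "letter \<Rightarrow> bool" where "is_pos x = snd (snd x)"

definition wf_gauss :: "gauss \<Rightarrow> bool" where
  "wf_gauss w \<longleftrightarrow> (\<forall>x \<in> set w. count_list (map lbl w) (lbl x) = 2 \<and>
      (\<exists>s. (lbl x, True, s) \<in> set w \<and> (lbl x, False, s) \<in> set w))"

definition crossings :: "gauss \<Rightarrow> nat" where
  "crossings w = length w div 2"

text \<open>Ribbon-graph (Carter surface) structure. Darts are (p, True) = half-edge leaving
the crossing at passage p, (p, False) = half-edge entering it.\<close>
definition partner :: "gauss \<Rightarrow> nat \<Rightarrow> nat" where
  "partner w p = (THE q. q < length w \<and> q \<noteq> p \<and> lbl (w ! q) = lbl (w ! p))"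

definition dart_alpha :: "gauss \<Rightarrow> nat \<times> bool \<Rightarrow> nat \<times> bool" where
  "dart_alpha w d = (if snd d then (Suc (fst d) mod length w, False)
                     else ((fst d + length w - 1) mod length w, True))"

text \<open>Counterclockwise rotation at a crossing: at a positive crossing the cyclic order is
over-out, under-out, over-in, under-in; at a negative one over and under are swapped.\<close>
definition dart_sigma :: "gauss \<Rightarrow> nat \<times> bool \<Rightarrow> nat \<times> bool" where
  "dart_sigma w d = (let q = partner w (fst d) in
      if is_over (w ! fst d) = is_pos (w ! fst d) then (q, snd d) else (q, \<not> snd d))"

definition face_perm :: "gauss \<Rightarrow> nat \<times> bool \<Rightarrow> nat \<times> bool" where
  "face_perm w = dart_sigma w \<circ> dart_alpha w"

definition darts :: "gauss \<Rightarrow> (nat \<times> bool) set" where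
  "darts w = {d. fst d < length w}"

definition face_orbit :: "gauss \<Rightarrow> nat \<times> bool \<Rightarrow> (nat \<times> bool) set" where
  "face_orbit w d = {(face_perm w ^^ k) d | k. True}"

definition num_faces :: "gauss \<Rightarrow> nat" where
  "num_faces w = card (face_orbit w ` darts w)"

text \<open>Classical (planar) diagram: the Carter surface is a sphere, i.e.
V - E + F = 2 with V = C, E = 2C.\<close>
definition classical :: "gauss \<Rightarrow> bool" where
  "classical w \<longleftrightarrow> w = [] \<or> num_faces w = crossings w + 2"

definition knot_diagram :: "gauss \<Rightarrow> bool" where
  "knot_diagram w \<longleftrightarrow> wf_gauss w \<and> classical w"

definition ascending :: "gauss \<Rightarrow> bool" where
  "ascending w \<longleftrightarrow> (\<forall>i j. i < j \<and> j < length w \<and> lbl (w ! i) = lbl (w ! j) \<longrightarrow>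
                       \<not> is_over (w ! i))"

definition descending :: "gauss \<Rightarrow> bool" where
  "descending w \<longleftrightarrow> (\<forall>i j. i < j \<and> j < length w \<and> lbl (w ! i) = lbl (w ! j) \<longrightarrow>
                       is_over (w ! i))"

definition same_diagram :: "gauss \<Rightarrow> gauss \<Rightarrow> bool" where
  "same_diagram w w' \<longleftrightarrow> (\<exists>k f. inj_on f (lbl ` set w) \<and>
      w' = map (\<lambda>(a, ov, s). (f a, ov, s)) (rotate k w))"

definition R1 :: "gauss \<Rightarrow> gauss \<Rightarrow> bool" where
  "R1 w w' \<longleftrightarrow> (\<exists>u v a ov s. w = u @ [(a, ov, s), (a, \<not> ov, s)] @ v \<and> w' = u @ v)"

definition R2 :: "gauss \<Rightarrow> gauss \<Rightarrow> bool" where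
  "R2 w w' \<longleftrightarrow> (\<exists>u v x a b ov s.
      (w = u @ [(a, ov, s), (b, ov, \<not> s)] @ v @ [(a, \<not> ov, s), (b, \<not> ov, \<not> s)] @ x \<or>
       w = u @ [(a, ov, s), (b, ov, \<not> s)] @ v @ [(b, \<not> ov, \<not> s), (a, \<not> ov, s)] @ x) \<and>
      w' = u @ v @ x)"

text \<open>R3: top strand passes over middle (crossing p) and bottom (crossing q), middle
passes over bottom (crossing r). The flags t, m, b give the order of the two passages on
each strand; the move reverses all three. The sign condition characterises which
configurations are realised by a triangle face.\<close>
definition r3_top :: "bool \<Rightarrow> nat \<Rightarrow> nat \<Rightarrow> bool \<Rightarrow> bool \<Rightarrow> gauss" where
  "r3_top t p q sp sq = (if t then [(p, True, sp), (q, True, sq)] else [(q, True, sq), (p, True, sp)])"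
definition r3_mid :: "bool \<Rightarrow> nat \<Rightarrow> nat \<Rightarrow> bool \<Rightarrow> bool \<Rightarrow> gauss" where
  "r3_mid m p r sp sr = (if m then [(p, False, sp), (r, True, sr)] else [(r, True, sr), (p, False, sp)])"
definition r3_bot :: "bool \<Rightarrow> nat \<Rightarrow> nat \<Rightarrow> bool \<Rightarrow> bool \<Rightarrow> gauss" where
  "r3_bot b q r sq sr = (if b then [(q, False, sq), (r, False, sr)] else [(r, False, sr), (q, False, sq)])"

definition R3 :: "gauss \<Rightarrow> gauss \<Rightarrow> bool" where
  "R3 w w' \<longleftrightarrow> (\<exists>u v y z t m b p q r sp sq sr.
      (sp \<noteq> sq) = (m \<noteq> b) \<and> (sq \<noteq> sr) = (t \<noteq> m) \<and>
      ((w = u @ r3_top t p q sp sq @ v @ r3_mid m p r sp sr @ y @ r3_bot b q r sq sr @ z \<and>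
        w' = u @ r3_top (\<not> t) p q sp sq @ v @ r3_mid (\<not> m) p r sp sr @ y @ r3_bot (\<not> b) q r sq sr @ z) \<or>
       (w = u @ r3_top t p q sp sq @ v @ r3_bot b q r sq sr @ y @ r3_mid m p r sp sr @ z \<and>
        w' = u @ r3_top (\<not> t) p q sp sq @ v @ r3_bot (\<not> b) q r sq sr @ y @ r3_mid (\<not> m) p r sp sr @ z)))"

definition basic_move :: "gauss \<Rightarrow> gauss \<Rightarrow> bool" where
  "basic_move w w' \<longleftrightarrow> R1 w w' \<or> R1 w' w \<or> R2 w w' \<or> R2 w' w \<or> R3 w w' \<or> R3 w' w"

definition reidemeister_move :: "gauss \<Rightarrow> gauss \<Rightarrow> bool" where
  "reidemeister_move w w' \<longleftrightarrow> knot_diagram w \<and> knot_diagram w' \<and>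
     (\<exists>w1 w2. same_diagram w w1 \<and> basic_move w1 w2 \<and> same_diagram w2 w')"

end

theory Submission
  imports Defs "HOL-Library.FuncSet"
begin

text \<open>
Planarity is used in the form of a homological criterion. Every subgraph of the projection with even
degrees is the boundary modulo 2 of a set of faces exactly if the Carter surface is a sphere: with
\<open>C\<close> crossings there are \<open>2 ^ (C + 1)\<close> such subgraphs, and two sets of faces have the same boundary
only if they are equal or complementary. The criterion is local, so that it can be checked for each move.

Follow the knot from the base point to its first self-crossing. This closes up a simple loop that lies
above (or below) everything it meets. While there is a crossing inside the loop, some strand enters the
loop and runs directly into such a crossing; an R2 move followed by an R3 move pushes the loop past it.
Afterwards the strands inside the loop are disjoint arcs, an innermost one is removed by an R2 move, and
finally the empty loop by an R1 move. For a loop met by \<open>2 k\<close> passages with \<open>m\<close> crossings inside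
this takes \<open>2 m + (k + m) + 1\<close> moves, and what remains is monotone with fewer crossings.
\<close>

section \<open>Letters and well-formed Gauss words\<close>

text \<open>A Gauss word carries no geometry, so what lies inside a loop or next to a strand must be
  read off the letters. The face count in \<open>classical\<close> does not tell how; a colouring of
  the faces by two colours with prescribed boundary does, and a move changes it only at the
  crossings involved. Every intermediate word must be shown planar, since
  \<open>reidemeister_move\<close> demands it, and an R2 move that creates crossings keeps planarity
  only if its strands border a common face. Adjacent letters certify such a face: the strand
  entering the loop at \<open>c\<close> meets \<open>d\<close> next.

  Monotonicity serves to find a loop whose passages are all over or all under. While the loop
  shrinks, the rest of the word is arbitrary: the loop strand is top or bottom of every triangle, so
  R3 applies whichever of the other two strands is higher. What finally remains is the original word
  without the loop and its crossings, so monotonicity is back for the next loop.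

  With k and m at most C, the count 3 m + k + 1 is at most 4 C + 1, within the 7 C + 1 allowed per
  loop, and there are at most C loops.\<close>

definition mate :: "letter \<Rightarrow> letter" where
  "mate x = (lbl x, \<not> is_over x, is_pos x)"

text \<open>True exactly if the other strand crosses this one from right to left; then
  \<open>dart_sigma\<close> keeps the in/out flag, and otherwise it flips it.\<close>

definition eps :: "letter \<Rightarrow> bool" where
  "eps x \<longleftrightarrow> is_over x = is_pos x"

lemma lbl_mate [simp]: "lbl (mate x) = lbl x"
  and is_over_mate [simp]: "is_over (mate x) \<longleftrightarrow> \<not> is_over x"
  and is_pos_mate [simp]: "is_pos (mate x) = is_pos x"
  and mate_mate [simp]: "mate (mate x) = x"
  and eps_mate [simp]: "eps (mate x) \<longleftrightarrow> \<not> eps x"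
  and mate_neq [simp]: "mate x \<noteq> x"
  and mate_neq' [simp]: "x \<noteq> mate x"
  by (cases x; auto simp: mate_def lbl_def is_over_def is_pos_def eps_def)+

lemma mate_eq_iff [simp]: "mate x = mate y \<longleftrightarrow> x = y"
  by (metis mate_mate)

lemma count_list_lbl: "count_list (map lbl w) a = length (filter (\<lambda>x. lbl x = a) w)"
  by (induction w) auto

text \<open>Two occurrences of a label, shared by an over- and an under-letter of one sign, leave no
  room for anything but \<open>x\<close> and \<open>mate x\<close>, once each. This trades counting
  for the involution \<open>mate\<close>.\<close>

lemma wf_gauss_iff:
  "wf_gauss w \<longleftrightarrow> distinct w \<and> (\<forall>x\<in>set w. {y\<in>set w. lbl y = lbl x} = {x, mate x})"
proof
  assume wf: "wf_gauss w"
  have pair: "distinct (filter (\<lambda>y. lbl y = lbl x) w) \<and> {y\<in>set w. lbl y = lbl x} = {x, mate x}"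
    if x: "x \<in> set w" for x
  proof -
    let ?F = "filter (\<lambda>y. lbl y = lbl x) w"
    obtain s where s: "(lbl x, True, s) \<in> set w" "(lbl x, False, s) \<in> set w"
      and len: "length ?F = 2"
      using wf x unfolding wf_gauss_def count_list_lbl by blast
    let ?y = "(lbl x, True, s)" and ?z = "(lbl x, False, s)"
    have sub: "{?y, ?z} \<subseteq> set ?F"
      using s by (auto simp: lbl_def)
    have "card (set ?F) \<le> 2"
      using card_length[of ?F] len by simp
    moreover have "card {?y, ?z} = 2"
      by simp
    ultimately have eq: "set ?F = {?y, ?z}"
      using card_seteq[OF _ sub] by simp
    then have "distinct ?F"
      using len by (intro card_distinct) simp
    moreover have "x \<in> {?y, ?z}"
      using eq x by auto
    then have "{?y, ?z} = {x, mate x}"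
      by (cases x) (auto simp: mate_def lbl_def is_over_def is_pos_def)
    ultimately show ?thesis
      using eq by auto
  qed
  have "distinct w"
  proof (rule ccontr)
    assume "\<not> distinct w"
    then obtain xs ys zs y where "w = xs @ [y] @ ys @ [y] @ zs"
      using not_distinct_decomp by blast
    then show False
      using pair[of y] by simp
  qed
  then show "distinct w \<and> (\<forall>x\<in>set w. {y\<in>set w. lbl y = lbl x} = {x, mate x})"
    using pair by blast
next
  assume r: "distinct w \<and> (\<forall>x\<in>set w. {y\<in>set w. lbl y = lbl x} = {x, mate x})"
  show "wf_gauss w"
    unfolding wf_gauss_def
  proof (intro ballI conjI)
    fix x assume x: "x \<in> set w"
    let ?F = "filter (\<lambda>y. lbl y = lbl x) w"
    have F: "set ?F = {x, mate x}"
      using r x by auto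
    have "distinct ?F"
      using r by simp
    then have "length ?F = card (set ?F)"
      by (simp only: distinct_card)
    then show "count_list (map lbl w) (lbl x) = 2"
      unfolding count_list_lbl F by simp
    have "mate x \<in> set w"
      using F by auto
    then show "\<exists>s. (lbl x, True, s) \<in> set w \<and> (lbl x, False, s) \<in> set w"
      using x by (cases x; cases "is_over x") (auto simp: mate_def lbl_def is_over_def is_pos_def)
  qed
qed

lemma wf_gauss_distinct: "wf_gauss w \<Longrightarrow> distinct w"
  by (simp add: wf_gauss_iff)

lemma wf_gauss_mate: "wf_gauss w \<Longrightarrow> x \<in> set w \<Longrightarrow> mate x \<in> set w"
  by (auto simp: wf_gauss_iff)

lemma wf_gauss_same_lbl:
  "wf_gauss w \<Longrightarrow> x \<in> set w \<Longrightarrow> y \<in> set w \<Longrightarrow> lbl y = lbl x \<Longrightarrow> y = x \<or> y = mate x"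
  by (auto simp: wf_gauss_iff)

lemma wf_gaussI:
  assumes "distinct w" "\<And>x. x \<in> set w \<Longrightarrow> mate x \<in> set w"
    "\<And>x y. x \<in> set w \<Longrightarrow> y \<in> set w \<Longrightarrow> lbl y = lbl x \<Longrightarrow> y = x \<or> y = mate x"
  shows "wf_gauss w"
proof -
  have "{y \<in> set w. lbl y = lbl x} = {x, mate x}" if "x \<in> set w" for x
    using assms(2,3)[OF that] that lbl_mate by blast
  with assms(1) show ?thesis
    by (simp add: wf_gauss_iff)
qed

lemma wf_gauss_perm: "wf_gauss w \<Longrightarrow> distinct w' \<Longrightarrow> set w' = set w \<Longrightarrow> wf_gauss w'"
  by (simp add: wf_gauss_iff)

lemma wf_gauss_length:
  assumes "wf_gauss w"
  shows "length w = 2 * card (lbl ` set w)"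
proof -
  have "(\<Sum>a\<in>set (map lbl w). count_list (map lbl w) a) = length (map lbl w)"
    by (rule sum_count_set) auto
  moreover have "(\<Sum>a\<in>set (map lbl w). count_list (map lbl w) a) = (\<Sum>a\<in>set (map lbl w). 2)"
    using assms by (intro sum.cong) (auto simp: wf_gauss_def)
  ultimately show ?thesis
    by simp
qed

lemma crossings_wf: "wf_gauss w \<Longrightarrow> crossings w = card (lbl ` set w)"
  by (simp add: crossings_def wf_gauss_length)

section \<open>A homological criterion for planarity\<close>

text \<open>A colouring of the faces around crossing \<open>a\<close>: in \<open>\<kappa> a h k\<close> the flag \<open>h\<close> says whether
the quadrant is to the left of the strand with \<^const>\<open>eps\<close>, and \<open>k\<close> whether it is to the left of
the other strand. A pair of colours gives the faces to the left and to the right of an edge.\<close>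

type_synonym colouring = "nat \<Rightarrow> bool \<Rightarrow> bool \<Rightarrow> bool"

text \<open>Let the strand with \<open>eps\<close> run north; the other one then runs west. The
  quadrants \<open>True True\<close>, \<open>False True\<close>, \<open>True False\<close>,
  \<open>False False\<close> are south-west, south-east, north-west, north-east.\<close>

definition inc :: "colouring \<Rightarrow> letter \<Rightarrow> bool \<times> bool" where
  "inc \<kappa> x = (let q = \<kappa> (lbl x) in if eps x then (q True True, q False True) else (q False True, q False False))"

definition outc :: "colouring \<Rightarrow> letter \<Rightarrow> bool \<times> bool" where
  "outc \<kappa> x = (let q = \<kappa> (lbl x) in if eps x then (q True False, q False False) else (q True True, q True False))"

text \<open>\<open>p\<close> and \<open>q\<close> are the colours beside the edges before and after
  the word. Agreement at every joint means that each edge sees the same two faces from both ends, so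
  \<open>walk \<kappa> p w p\<close> makes \<kappa> a colouring of the faces of the closed
  diagram.\<close>

fun walk :: "colouring \<Rightarrow> bool \<times> bool \<Rightarrow> gauss \<Rightarrow> bool \<times> bool \<Rightarrow> bool" where
  "walk \<kappa> p [] q \<longleftrightarrow> p = q"
| "walk \<kappa> p (x # w) q \<longleftrightarrow> inc \<kappa> x = p \<and> walk \<kappa> (outc \<kappa> x) w q"

text \<open>The parity of the four quadrants tells whether the boundary of the coloured faces turns
  at \<open>a\<close>: it then contains exactly one of the two edges of each strand there.\<close>

definition par :: "colouring \<Rightarrow> nat \<Rightarrow> bool" where
  "par \<kappa> a \<longleftrightarrow> ((\<kappa> a True True \<noteq> \<kappa> a True False) \<noteq> (\<kappa> a False True \<noteq> \<kappa> a False False))"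

text \<open>Every subgraph of the knot projection with even degrees bounds modulo 2: such subgraphs are
given by the set \<open>S\<close> of crossings at which they turn, together with one edge.\<close>

definition planar :: "gauss \<Rightarrow> bool" where
  "planar w \<longleftrightarrow> (\<forall>S p. \<exists>\<kappa>. walk \<kappa> p w p \<and> (\<forall>a\<in>lbl ` set w. par \<kappa> a \<longleftrightarrow> a \<in> S))"

text \<open>Despite the name a property of an edge: it lies on the boundary of the coloured
  faces.\<close>

abbreviation turn :: "bool \<times> bool \<Rightarrow> bool" where
  "turn p \<equiv> fst p \<noteq> snd p"

lemma walk_append [simp]: "walk \<kappa> p (u @ v) q \<longleftrightarrow> (\<exists>r. walk \<kappa> p u r \<and> walk \<kappa> r v q)"
  by (induction u arbitrary: p) auto

lemma turn_outc: "turn (outc \<kappa> x) \<longleftrightarrow> turn (inc \<kappa> x) \<noteq> par \<kappa> (lbl x)"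
  by (auto simp: inc_def outc_def par_def Let_def)

section \<open>Face colourings as invariant sets of darts\<close>

lemma walk_nth_iff:
  "walk \<kappa> p w q \<longleftrightarrow> (if w = [] then p = q else p = inc \<kappa> (hd w) \<and> q = outc \<kappa> (last w) \<and>
     (\<forall>i. Suc i < length w \<longrightarrow> outc \<kappa> (w ! i) = inc \<kappa> (w ! Suc i)))"
proof (induction w arbitrary: p)
  case (Cons x w)
  have "(\<forall>i. Suc i < length (x # w) \<longrightarrow> outc \<kappa> ((x # w) ! i) = inc \<kappa> ((x # w) ! Suc i)) \<longleftrightarrow>
    (w \<noteq> [] \<longrightarrow> outc \<kappa> x = inc \<kappa> (hd w)) \<and> (\<forall>i. Suc i < length w \<longrightarrow> outc \<kappa> (w ! i) = inc \<kappa> (w ! Suc i))"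
    (is "?l \<longleftrightarrow> ?r")
  proof
    show "?l \<Longrightarrow> ?r"
      by (auto simp: hd_conv_nth dest: spec[of _ 0] spec[of _ "Suc _"])
    show "?r \<Longrightarrow> ?l"
      by (auto simp: nth_Cons hd_conv_nth split: nat.split)
  qed
  note * = this
  show ?case
  proof (cases "w = []")
    case False
    have "walk \<kappa> p (x # w) q \<longleftrightarrow> p = inc \<kappa> x \<and> q = outc \<kappa> (last w) \<and> outc \<kappa> x = inc \<kappa> (hd w) \<and>
        (\<forall>i. Suc i < length w \<longrightarrow> outc \<kappa> (w ! i) = inc \<kappa> (w ! Suc i))"
      unfolding walk.simps Cons.IH if_not_P[OF False] by blast
    with False show ?thesis
      unfolding * by simp blast?
  qed auto
qed simp

lemma closed_walk_nth_iff:
  assumes "w \<noteq> []"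
  shows "walk \<kappa> p w p \<longleftrightarrow> p = inc \<kappa> (hd w) \<and>
    (\<forall>i<length w. outc \<kappa> (w ! i) = inc \<kappa> (w ! (Suc i mod length w)))"
proof -
  have "(\<forall>i<length w. outc \<kappa> (w ! i) = inc \<kappa> (w ! (Suc i mod length w))) \<longleftrightarrow>
    outc \<kappa> (last w) = inc \<kappa> (hd w) \<and> (\<forall>i. Suc i < length w \<longrightarrow> outc \<kappa> (w ! i) = inc \<kappa> (w ! Suc i))"
    (is "?l \<longleftrightarrow> ?r")
  proof
    assume l: ?l
    have "outc \<kappa> (last w) = inc \<kappa> (hd w)"
      using l assms spec[OF l, of "length w - 1"] by (simp add: last_conv_nth hd_conv_nth)
    moreover have "\<forall>i. Suc i < length w \<longrightarrow> outc \<kappa> (w ! i) = inc \<kappa> (w ! Suc i)"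
      using l by auto
    ultimately show ?r
      by simp
  next
    assume r: ?r
    show ?l
    proof (intro allI impI)
      fix i assume "i < length w"
      then consider "Suc i < length w" | "Suc i = length w"
        by linarith
      then show "outc \<kappa> (w ! i) = inc \<kappa> (w ! (Suc i mod length w))"
      proof cases
        case 2
        then have "i = length w - 1"
          by simp
        with 2 r assms show ?thesis
          by (simp add: last_conv_nth hd_conv_nth)
      qed (use r in auto)
    qed
  qed
  then show ?thesis
    using assms unfolding walk_nth_iff by auto
qed

text \<open>Invariant sets are the unions of orbits. Orbits are built by forward iteration only, but
  an injective self-map of a finite set permutes each of them; so they are closed under predecessors
  too, and any two are equal or disjoint.\<close>

lemma card_invariant_sets:
  assumes fin: "finite D" and maps: "f ` D \<subseteq> D" and inj: "inj_on f D"
  shows "card {A. A \<subseteq> D \<and> (\<forall>d\<in>D. f d \<in> A \<longleftrightarrow> d \<in> A)} =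
    2 ^ card ((\<lambda>d. {(f ^^ k) d | k. True}) ` D)"
proof -
  define orb where "orb d = {(f ^^ k) d | k. True}" for d
  let ?K = "{A. A \<subseteq> D \<and> (\<forall>d\<in>D. f d \<in> A \<longleftrightarrow> d \<in> A)}"
  have orb_self: "d \<in> orb d" for d
    unfolding orb_def by (auto intro: exI[of _ 0])
  have orb_step: "f e \<in> orb d" if "e \<in> orb d" for d e
  proof -
    obtain k where "e = (f ^^ k) d"
      using \<open>e \<in> orb d\<close> unfolding orb_def by auto
    then have "f e = (f ^^ Suc k) d"
      by simp
    then show ?thesis
      unfolding orb_def by blast
  qed
  have orb_D: "orb d \<subseteq> D" if "d \<in> D" for d
  proof
    fix e assume "e \<in> orb d"
    then obtain k where e: "e = (f ^^ k) d"
      unfolding orb_def by auto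
    have "(f ^^ k) d \<in> D" for k
      using that maps by (induction k) auto
    then show "e \<in> D"
      unfolding e .
  qed
  have orb_sub: "orb d \<subseteq> A" if "d \<in> A" "A \<in> ?K" for d A
  proof
    fix e assume "e \<in> orb d"
    then obtain k where e: "e = (f ^^ k) d"
      unfolding orb_def by auto
    have "(f ^^ k) d \<in> A" for k
      using that by (induction k) auto
    then show "e \<in> A"
      unfolding e .
  qed
  have orb_K: "orb d \<in> ?K" if d: "d \<in> D" for d
  proof -
    have "f ` orb d \<subseteq> orb d"
      using orb_step by auto
    moreover have "inj_on f (orb d)" "finite (orb d)"
      using inj fin orb_D[OF d] by (auto intro: inj_on_subset finite_subset)
    ultimately have onto: "f ` orb d = orb d"
      by (intro endo_inj_surj)
    have "e \<in> orb d" if e: "e \<in> D" "f e \<in> orb d" for e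
    proof -
      obtain e' where "e' \<in> orb d" "f e = f e'"
        using onto e by auto
      then show ?thesis
        using inj_onD[OF inj, of e e'] e orb_D[OF d] by auto
    qed
    then show ?thesis
      using orb_D[OF d] orb_step by auto
  qed
  have orb_sym: "d \<in> orb e" if "d \<in> D" "e \<in> orb d" for d e
  proof -
    obtain k where e: "e = (f ^^ k) d"
      using \<open>e \<in> orb d\<close> unfolding orb_def by auto
    have K: "orb e \<in> ?K"
      using orb_K orb_D that by blast
    have "(f ^^ k) d \<in> D" for k
      using orb_D[OF \<open>d \<in> D\<close>] unfolding orb_def by auto
    then have "(f ^^ k) d \<in> orb e \<Longrightarrow> d \<in> orb e" for k
      using K by (induction k) auto
    then show ?thesis
      using orb_self[of e] unfolding e by blast
  qed
  have orb_meet: "orb d = orb e" if "d \<in> D" "e \<in> orb d" for d e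
    using that orb_sub orb_K orb_D orb_sym by (meson subset_antisym subsetD)
  have "bij_betw Union (Pow (orb ` D)) ?K"
  proof (rule bij_betwI[where g = "\<lambda>A. orb ` A"])
    show "Union \<in> Pow (orb ` D) \<rightarrow> ?K"
    proof
      fix U assume "U \<in> Pow (orb ` D)"
      then have "X \<in> ?K" if "X \<in> U" for X
        using orb_K that by blast
      then show "\<Union>U \<in> ?K"
        by blast
    qed
    show "(\<lambda>A. orb ` A) \<in> ?K \<rightarrow> Pow (orb ` D)"
      by auto
    show "orb ` (\<Union>U) = U" if U: "U \<in> Pow (orb ` D)" for U
    proof (intro equalityI subsetI)
      fix X assume "X \<in> orb ` (\<Union>U)"
      then obtain e Y where e: "X = orb e" "e \<in> Y" "Y \<in> U"
        by auto
      moreover obtain d where "d \<in> D" "Y = orb d"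
        using U e by blast
      ultimately show "X \<in> U"
        using orb_meet by simp
    next
      fix X assume "X \<in> U"
      moreover from this obtain d where "X = orb d"
        using U by blast
      ultimately show "X \<in> orb ` (\<Union>U)"
        using orb_self by blast
    qed
    show "\<Union> (orb ` A) = A" if "A \<in> ?K" for A
    proof
      show "\<Union> (orb ` A) \<subseteq> A"
        using orb_sub[OF _ that] by (rule UN_least)
      show "A \<subseteq> \<Union> (orb ` A)"
        using orb_self by (intro subsetI UN_I)
    qed
  qed
  then have "card ?K = card (Pow (orb ` D))"
    by (simp add: bij_betw_same_card)
  then show ?thesis
    using fin by (simp add: card_Pow orb_def[abs_def])
qed

lemma partner_wf:
  assumes wf: "wf_gauss w" and i: "i < length w"
  shows "partner w i < length w" "partner w i \<noteq> i" "w ! partner w i = mate (w ! i)"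
proof -
  have dist: "distinct w"
    using wf by (rule wf_gauss_distinct)
  have "mate (w ! i) \<in> set w"
    using wf i by (simp add: wf_gauss_mate)
  then obtain q where q: "q < length w" "w ! q = mate (w ! i)"
    by (auto simp: in_set_conv_nth)
  have "partner w i = q"
    unfolding partner_def
  proof (rule the_equality)
    show "q < length w \<and> q \<noteq> i \<and> lbl (w ! q) = lbl (w ! i)"
      using q by (metis lbl_mate mate_neq)
  next
    fix r assume r: "r < length w \<and> r \<noteq> i \<and> lbl (w ! r) = lbl (w ! i)"
    then have "w ! r \<noteq> w ! i"
      using dist i by (simp add: nth_eq_iff_index_eq)
    then have "w ! r = w ! q"
      using wf_gauss_same_lbl[OF wf, of "w ! i" "w ! r"] r i q by auto
    then show "r = q"
      using nth_eq_iff_index_eq[OF dist] r q by blast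
  qed
  with q show "partner w i < length w" "partner w i \<noteq> i" "w ! partner w i = mate (w ! i)"
    by (metis mate_neq)+
qed

lemma partner_partner:
  assumes wf: "wf_gauss w" and i: "i < length w"
  shows "partner w (partner w i) = i"
proof -
  have "w ! partner w (partner w i) = w ! i" "partner w (partner w i) < length w"
    using partner_wf[OF wf i] partner_wf[OF wf, of "partner w i"] by simp_all
  then show ?thesis
    using wf_gauss_distinct[OF wf] i by (simp add: nth_eq_iff_index_eq)
qed

lemma dart_sigma_eq:
  "dart_sigma w d = (partner w (fst d), if eps (w ! fst d) then snd d else \<not> snd d)"
  by (simp add: dart_sigma_def Let_def eps_def)

lemma dart_sigma_bij:
  assumes wf: "wf_gauss w"
  shows "dart_sigma w ` darts w \<subseteq> darts w" "inj_on (dart_sigma w) (darts w)"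
proof -
  show "dart_sigma w ` darts w \<subseteq> darts w"
    using partner_wf[OF wf] by (auto simp: dart_sigma_eq darts_def)
  show "inj_on (dart_sigma w) (darts w)"
  proof (rule inj_onI)
    fix d e assume de: "d \<in> darts w" "e \<in> darts w" "dart_sigma w d = dart_sigma w e"
    then have "partner w (fst d) = partner w (fst e)"
      by (simp add: dart_sigma_eq)
    then have "fst d = fst e"
      using de(1,2) partner_partner[OF wf] unfolding darts_def by (metis mem_Collect_eq)
    with de(3) show "d = e"
      by (auto simp: dart_sigma_eq prod_eq_iff split: if_splits)
  qed
qed

lemma dart_alpha_bij:
  shows "dart_alpha w ` darts w \<subseteq> darts w" "inj_on (dart_alpha w) (darts w)"
proof -
  have inv: "dart_alpha w (dart_alpha w d) = d" and mem: "dart_alpha w d \<in> darts w"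
    if "d \<in> darts w" for d
  proof -
    obtain i b where d: "d = (i, b)" and i: "i < length w"
      using \<open>d \<in> darts w\<close> by (cases d) (auto simp: darts_def)
    show "dart_alpha w d \<in> darts w"
      using i by (auto simp: d dart_alpha_def darts_def intro: mod_less_divisor)
    have "(Suc i mod length w + length w - 1) mod length w = i"
      using i by (cases "Suc i = length w") auto
    moreover have "Suc ((i + length w - 1) mod length w) mod length w = i"
      using i by (cases i) (auto simp: mod_Suc_eq)
    ultimately show "dart_alpha w (dart_alpha w d) = d"
      by (simp add: d dart_alpha_def)
  qed
  show "dart_alpha w ` darts w \<subseteq> darts w"
    using mem by auto
  show "inj_on (dart_alpha w) (darts w)"
    by (rule inj_on_inverseI[where g = "dart_alpha w"]) (rule inv)
qed

lemma face_perm_bij: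
  assumes wf: "wf_gauss w"
  shows "face_perm w ` darts w \<subseteq> darts w" "inj_on (face_perm w) (darts w)"
proof -
  show "face_perm w ` darts w \<subseteq> darts w"
    using dart_alpha_bij(1) dart_sigma_bij(1)[OF wf] unfolding face_perm_def by fastforce
  show "inj_on (face_perm w) (darts w)"
    unfolding face_perm_def
    by (intro comp_inj_on dart_alpha_bij inj_on_subset[OF dart_sigma_bij(2)[OF wf]])
qed

lemma finite_darts: "finite (darts w)" 
proof -
  have "darts w = {..<length w} \<times> UNIV"
    by (auto simp: darts_def)
  then show ?thesis
    by simp
qed

definition face_sets :: "gauss \<Rightarrow> (nat \<times> bool) set set" where
  "face_sets w = {A. A \<subseteq> darts w \<and> (\<forall>d\<in>darts w. face_perm w d \<in> A \<longleftrightarrow> d \<in> A)}"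

lemma card_face_sets: "wf_gauss w \<Longrightarrow> card (face_sets w) = 2 ^ num_faces w"
  unfolding face_sets_def num_faces_def face_orbit_def
  by (intro card_invariant_sets finite_darts face_perm_bij)

text \<open>Colours at absent labels are normalised so that the set is finite and can be
  counted.\<close>

definition face_colourings :: "gauss \<Rightarrow> colouring set" where
  "face_colourings w = {\<kappa>. (\<forall>a. a \<notin> lbl ` set w \<longrightarrow> \<kappa> a = (\<lambda>_ _. False)) \<and>
     (\<forall>i<length w. outc \<kappa> (w ! i) = inc \<kappa> (w ! (Suc i mod length w)))}"

text \<open>\<open>face_perm\<close> traces the face to the right of a dart pointing away from its
  crossing, and the dart carries the colour of that face. For an entering half-edge this is the left
  side of the strand, hence \<open>fst\<close>.\<close>

definition face_darts :: "gauss \<Rightarrow> colouring \<Rightarrow> (nat \<times> bool) set" where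
  "face_darts w \<kappa> = {(i, b). i < length w \<and> (if b then snd (outc \<kappa> (w ! i)) else fst (inc \<kappa> (w ! i)))}"

lemma face_darts_iff:
  "(i, True) \<in> face_darts w \<kappa> \<longleftrightarrow> i < length w \<and> snd (outc \<kappa> (w ! i))"
  "(i, False) \<in> face_darts w \<kappa> \<longleftrightarrow> i < length w \<and> fst (inc \<kappa> (w ! i))"
  by (simp_all add: face_darts_def)

text \<open>The dart following \<open>d\<close> in its face carries the colour of the same side of the edge of \<open>d\<close>.\<close>

lemma face_darts_perm:
  assumes wf: "wf_gauss w" and i: "i < length w"
  shows "face_perm w (i, True) \<in> face_darts w \<kappa> \<longleftrightarrow> snd (inc \<kappa> (w ! (Suc i mod length w)))"
    and "face_perm w (Suc i mod length w, False) \<in> face_darts w \<kappa> \<longleftrightarrow> fst (outc \<kappa> (w ! i))"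
proof -
  have j: "Suc i mod length w < length w"
    using i by (intro mod_less_divisor) linarith
  have "(Suc i mod length w + length w - 1) mod length w = i"
    using i by (cases "Suc i = length w") auto
  then show "face_perm w (Suc i mod length w, False) \<in> face_darts w \<kappa> \<longleftrightarrow> fst (outc \<kappa> (w ! i))"
    using partner_wf[OF wf i]
    by (auto simp: face_perm_def dart_alpha_def dart_sigma_eq face_darts_iff inc_def outc_def Let_def)
  show "face_perm w (i, True) \<in> face_darts w \<kappa> \<longleftrightarrow> snd (inc \<kappa> (w ! (Suc i mod length w)))"
    using partner_wf[OF wf j]
    by (auto simp: face_perm_def dart_alpha_def dart_sigma_eq face_darts_iff inc_def outc_def Let_def)
qed

lemma Suc_mod_surj:
  assumes "j < n"
  obtains i where "i < n" "j = Suc i mod n"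
proof (cases j)
  case 0
  with assms that[of "n - 1"] show ?thesis
    by simp
next
  case (Suc i)
  with assms that[of i] show ?thesis
    by simp
qed

text \<open>The two darts of an edge carry its right and its left colour; invariance at both says
  that the pairs seen from the two ends agree.\<close>

lemma face_darts_in_face_sets:
  assumes wf: "wf_gauss w"
  shows "face_darts w \<kappa> \<in> face_sets w \<longleftrightarrow>
    (\<forall>i<length w. outc \<kappa> (w ! i) = inc \<kappa> (w ! (Suc i mod length w)))"
proof
  assume A: "face_darts w \<kappa> \<in> face_sets w"
  show "\<forall>i<length w. outc \<kappa> (w ! i) = inc \<kappa> (w ! (Suc i mod length w))"
  proof (intro allI impI)
    fix i assume i: "i < length w"
    then have j: "Suc i mod length w < length w"
      by (intro mod_less_divisor) linarith
    have "(i, True) \<in> darts w" "(Suc i mod length w, False) \<in> darts w"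
      using i j by (auto simp: darts_def)
    then have "face_perm w (i, True) \<in> face_darts w \<kappa> \<longleftrightarrow> (i, True) \<in> face_darts w \<kappa>"
      "face_perm w (Suc i mod length w, False) \<in> face_darts w \<kappa> \<longleftrightarrow> (Suc i mod length w, False) \<in> face_darts w \<kappa>"
      using A unfolding face_sets_def by blast+
    then show "outc \<kappa> (w ! i) = inc \<kappa> (w ! (Suc i mod length w))"
      using i j unfolding face_darts_perm[OF wf i] face_darts_iff by (simp add: prod_eq_iff)
  qed
next
  assume r: "\<forall>i<length w. outc \<kappa> (w ! i) = inc \<kappa> (w ! (Suc i mod length w))"
  have "face_perm w (j, b) \<in> face_darts w \<kappa> \<longleftrightarrow> (j, b) \<in> face_darts w \<kappa>" if j: "j < length w" for j b
  proof (cases b)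
    case True
    with r j show ?thesis
      by (simp add: face_darts_perm[OF wf j] face_darts_iff)
  next
    case False
    obtain i where "i < length w" "j = Suc i mod length w"
      using Suc_mod_surj[OF j] .
    with False r j show ?thesis
      by (simp add: face_darts_perm[OF wf] face_darts_iff)
  qed
  then show "face_darts w \<kappa> \<in> face_sets w"
    unfolding face_sets_def by (auto simp: darts_def face_darts_def)
qed

lemma wf_gauss_eps_index:
  assumes wf: "wf_gauss w" and a: "a \<in> lbl ` set w"
  shows "\<exists>!i. i < length w \<and> lbl (w ! i) = a \<and> eps (w ! i) = b"
proof -
  obtain x where x: "x \<in> set w" "lbl x = a" 
    using a by auto
  define y where "y = (if eps x = b then x else mate x)"
  have y: "y \<in> set w" "lbl y = a" "eps y = b"
    using x wf_gauss_mate[OF wf] by (auto simp: y_def)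
  then obtain i where i: "i < length w" "w ! i = y"
    by (auto simp: in_set_conv_nth)
  show ?thesis
  proof (rule ex1I[of _ i])
    show "i < length w \<and> lbl (w ! i) = a \<and> eps (w ! i) = b"
      using i y by simp
    fix j assume j: "j < length w \<and> lbl (w ! j) = a \<and> eps (w ! j) = b"
    then have "w ! j = y"
      using wf_gauss_same_lbl[OF wf y(1), of "w ! j"] y by auto
    then show "j = i"
      using i j nth_eq_iff_index_eq[OF wf_gauss_distinct[OF wf]] by blast
  qed
qed

lemma bij_betw_face_darts:
  assumes wf: "wf_gauss w"
  shows "bij_betw (face_darts w) (face_colourings w) (face_sets w)"
proof -
  define idx where "idx a b = (THE i. i < length w \<and> lbl (w ! i) = a \<and> eps (w ! i) = b)" for a b
  have idx: "idx a b < length w" "lbl (w ! idx a b) = a" "eps (w ! idx a b) = b"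
    if "a \<in> lbl ` set w" for a b
    using theI'[OF wf_gauss_eps_index[OF wf that, of b]] by (simp_all add: idx_def)
  have idx_nth: "idx (lbl (w ! i)) (eps (w ! i)) = i" if "i < length w" for i
    unfolding idx_def using wf_gauss_eps_index[OF wf, of "lbl (w ! i)" "eps (w ! i)"] that
    by (intro the1_equality) auto
  \<comment> \<open>The four quadrants at \<open>a\<close> match its four half-edges:
    \<open>h = k\<close> selects the strand with \<open>eps\<close>, and \<open>\<not> k\<close> the
    half that leaves the crossing.\<close>
  define col where "col A a h k \<longleftrightarrow> a \<in> lbl ` set w \<and> (idx a (h = k), \<not> k) \<in> A" for A a h k
  have col_darts: "face_darts w (col A) = A" if A: "A \<subseteq> darts w" for A
  proof -
    have "(i, b) \<in> face_darts w (col A) \<longleftrightarrow> (i, b) \<in> A" if i: "i < length w" for i b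
    proof -
      have "lbl (w ! i) \<in> lbl ` set w"
        using i by simp
      moreover have "idx (lbl (w ! i)) True = i" if "eps (w ! i)"
        using idx_nth[OF i] that by simp
      moreover have "idx (lbl (w ! i)) False = i" if "\<not> eps (w ! i)"
        using idx_nth[OF i] that by simp
      ultimately show ?thesis
        using i unfolding face_darts_def inc_def outc_def col_def Let_def
        by (cases b; cases "eps (w ! i)") auto
    qed
    moreover have "i < length w" if "(i, b) \<in> A \<or> (i, b) \<in> face_darts w (col A)" for i b
      using that A by (auto simp: darts_def face_darts_def)
    ultimately have "d \<in> face_darts w (col A) \<longleftrightarrow> d \<in> A" for d
      by (cases d) blast
    then show ?thesis
      by blast
  qed
  have darts_col: "col (face_darts w \<kappa>) = \<kappa>" if "\<kappa> \<in> face_colourings w" for \<kappa>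
  proof (intro ext)
    fix a h k
    show "col (face_darts w \<kappa>) a h k = \<kappa> a h k"
    proof (cases "a \<in> lbl ` set w")
      case True
      show ?thesis
        using True idx[OF True, of "h = k"]
        by (cases h; cases k) (simp_all add: col_def face_darts_def inc_def outc_def Let_def)
    next
      case False
      then have "\<kappa> a = (\<lambda>_ _. False)"
        using that unfolding face_colourings_def by blast
      with False show ?thesis
        by (simp add: col_def)
    qed
  qed
  show ?thesis
  proof (rule bij_betwI[where g = col])
    show "face_darts w \<in> face_colourings w \<rightarrow> face_sets w"
      using face_darts_in_face_sets[OF wf] by (auto simp: face_colourings_def)
    show "col \<in> face_sets w \<rightarrow> face_colourings w"
    proof
      fix A assume A: "A \<in> face_sets w"
      then have "face_darts w (col A) \<in> face_sets w"
        using col_darts[of A] by (simp add: face_sets_def)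
      then have "\<forall>i<length w. outc (col A) (w ! i) = inc (col A) (w ! (Suc i mod length w))"
        unfolding face_darts_in_face_sets[OF wf] .
      then show "col A \<in> face_colourings w"
        by (auto simp: face_colourings_def col_def fun_eq_iff)
    qed
    show "col (face_darts w \<kappa>) = \<kappa>" if "\<kappa> \<in> face_colourings w" for \<kappa>
      using that by (rule darts_col)
    show "face_darts w (col A) = A" if "A \<in> face_sets w" for A
      using that col_darts by (simp add: face_sets_def)
  qed
qed

lemma card_face_colourings:
  assumes "wf_gauss w"
  shows "card (face_colourings w) = 2 ^ num_faces w"
  using bij_betw_same_card[OF bij_betw_face_darts[OF assms]] card_face_sets[OF assms] by (rule trans)

section \<open>Counting colourings by their boundary\<close>

lemma walk_turns:
  assumes "walk \<kappa> p w q" "walk \<kappa>' p' w q'" "turn p = turn p'"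
    "\<And>a. a \<in> lbl ` set w \<Longrightarrow> par \<kappa> a = par \<kappa>' a" "x \<in> set w"
  shows "turn (inc \<kappa> x) = turn (inc \<kappa>' x)"
  using assms
proof (induction w arbitrary: p p')
  case (Cons y w)
  have "turn (outc \<kappa> y) = turn (outc \<kappa>' y)"
    unfolding turn_outc using Cons.prems by simp
  with Cons.prems Cons.IH[of "outc \<kappa> y" "outc \<kappa>' y"] show ?case
    by (cases "x = y") simp_all
qed simp

text \<open>By \<open>walk_turns\<close> the start and the parities determine which edges lie on the
  boundary. Following the word, the edge entering \<open>x\<close> gives two quadrants, the status
  of the edge entering \<open>mate x\<close> a third, and the parity the fourth.\<close>

lemma walk_eq:
  assumes wf: "wf_gauss w"
    and w: "walk \<kappa> p w q" "walk \<kappa>' p w q'"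
    and par: "\<And>a. a \<in> lbl ` set w \<Longrightarrow> par \<kappa> a = par \<kappa>' a" and a: "a \<in> lbl ` set w"
  shows "\<kappa> a = \<kappa>' a"
proof -
  have turn: "turn (inc \<kappa> x) = turn (inc \<kappa>' x)" if "x \<in> set w" for x
    using walk_turns[OF w _ par that] by simp
  have one: "\<kappa> (lbl x) = \<kappa>' (lbl x)" if x: "x \<in> set w" and eq: "inc \<kappa> x = inc \<kappa>' x" for x
  proof -
    have t: "turn (inc \<kappa> (mate x)) = turn (inc \<kappa>' (mate x))"
      using turn wf_gauss_mate[OF wf x] by blast
    have p: "par \<kappa> (lbl x) = par \<kappa>' (lbl x)"
      using par x by simp
    have "\<kappa> (lbl x) h k = \<kappa>' (lbl x) h k" for h k
      using t p eq by (cases h; cases k; cases "eps x") (auto simp: inc_def par_def Let_def)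
    then show ?thesis
      by blast
  qed
  have all: "\<forall>x\<in>set v. \<kappa> (lbl x) = \<kappa>' (lbl x)"
    if "walk \<kappa> r v s" "walk \<kappa>' r v s'" "set v \<subseteq> set w" for r v s s'
    using that
  proof (induction v arbitrary: r)
    case (Cons x v)
    then have "\<kappa> (lbl x) = \<kappa>' (lbl x)"
      using one[of x] by simp
    moreover from this have "outc \<kappa> x = outc \<kappa>' x"
      by (simp add: outc_def)
    moreover from this have "\<forall>y\<in>set v. \<kappa> (lbl y) = \<kappa>' (lbl y)"
      using Cons.IH[of "outc \<kappa> x"] Cons.prems by simp
    ultimately show ?case
      by simp
  qed simp
  obtain x where "x \<in> set w" "a = lbl x"
    using a by (rule imageE)
  then show ?thesis
    using bspec[OF all[OF w order.refl]] by simp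
qed

lemma walk_cong:
  assumes "\<And>a. a \<in> lbl ` set w \<Longrightarrow> \<kappa> a = \<kappa>' a"
  shows "walk \<kappa> p w q = walk \<kappa>' p w q"
  using assms
proof (induction w arbitrary: p)
  case (Cons x w)
  have "walk \<kappa> r w q = walk \<kappa>' r w q" for r
    using Cons.IH[of r] Cons.prems by simp
  moreover have "\<kappa> (lbl x) = \<kappa>' (lbl x)"
    using Cons.prems by simp
  ultimately show ?case
    by (simp add: inc_def outc_def)
qed simp

lemma par_cong: "\<kappa> a = \<kappa>' a \<Longrightarrow> par \<kappa> a = par \<kappa>' a"
  by (simp add: par_def)

text \<open>By \<open>walk_eq\<close> the map \<open>turns\<close> is injective on any Carter
  surface, so its surjectivity, which is \<open>planar\<close>, amounts to equal cardinalities: 2 ^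
  F colourings for F faces against 2 ^ C sets of turns times 4 pairs. The pair fixes the status of
  the base edge and also chooses between a set of faces and its complement, hence the exponent C +
  2.\<close>

theorem classical_iff_planar:
  assumes wf: "wf_gauss w"
  shows "classical w \<longleftrightarrow> planar w"
proof (cases "w = []")
  case True
  then show ?thesis
    by (simp add: classical_def planar_def)
next
  case False
  define turns where "turns \<kappa> = ({a\<in>lbl ` set w. par \<kappa> a}, inc \<kappa> (hd w))" for \<kappa>
  let ?T = "Pow (lbl ` set w) \<times> (UNIV :: (bool \<times> bool) set)"
  have mem: "\<kappa> \<in> face_colourings w \<longleftrightarrow>
      (\<forall>a. a \<notin> lbl ` set w \<longrightarrow> \<kappa> a = (\<lambda>_ _. False)) \<and> walk \<kappa> (inc \<kappa> (hd w)) w (inc \<kappa> (hd w))" for \<kappa>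
    unfolding face_colourings_def closed_walk_nth_iff[OF False] by simp
  have inj: "inj_on turns (face_colourings w)"
  proof (rule inj_onI, rule ext)
    fix \<kappa> \<kappa>' a
    assume \<kappa>: "\<kappa> \<in> face_colourings w" "\<kappa>' \<in> face_colourings w" and eq: "turns \<kappa> = turns \<kappa>'"
    have par: "par \<kappa> b = par \<kappa>' b" if "b \<in> lbl ` set w" for b
      using eq that unfolding turns_def by blast
    have "inc \<kappa> (hd w) = inc \<kappa>' (hd w)"
      using eq by (simp add: turns_def)
    then have walk: "walk \<kappa> (inc \<kappa> (hd w)) w (inc \<kappa> (hd w))" "walk \<kappa>' (inc \<kappa> (hd w)) w (inc \<kappa> (hd w))"
      using \<kappa> unfolding mem by simp_all
    show "\<kappa> a = \<kappa>' a"
    proof (cases "a \<in> lbl ` set w")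
      case True
      show ?thesis
        by (rule walk_eq[OF wf walk par True])
    next
      case False
      with \<kappa> show ?thesis
        unfolding mem by simp
    qed
  qed
  have sub: "turns ` face_colourings w \<subseteq> ?T"
    by (auto simp: turns_def)
  have cardT: "card ?T = 2 ^ (crossings w + 2)"
    by (simp add: card_cartesian_product card_Pow crossings_wf[OF wf] card_UNIV_bool UNIV_Times_UNIV[symmetric] del: UNIV_Times_UNIV)
  have "classical w \<longleftrightarrow> card (face_colourings w) = card ?T"
    unfolding cardT card_face_colourings[OF wf] classical_def
    using False power_inject_exp[of "2 :: nat" "num_faces w" "crossings w + 2"] by auto
  also have "\<dots> \<longleftrightarrow> turns ` face_colourings w = ?T"
  proof
    assume "card (face_colourings w) = card ?T"
    then show "turns ` face_colourings w = ?T"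
      using sub by (intro card_subset_eq) (simp_all add: card_image[OF inj])
  next
    assume "turns ` face_colourings w = ?T"
    then show "card (face_colourings w) = card ?T"
      using card_image[OF inj] by simp
  qed
  also have "\<dots> \<longleftrightarrow> planar w"
  proof
    assume onto: "turns ` face_colourings w = ?T"
    show "planar w"
      unfolding planar_def
    proof (intro allI)
      fix S p
      have "(S \<inter> lbl ` set w, p) \<in> turns ` face_colourings w"
        unfolding onto by auto
      then obtain \<kappa> where "\<kappa> \<in> face_colourings w" "turns \<kappa> = (S \<inter> lbl ` set w, p)"
        by force
      then show "\<exists>\<kappa>. walk \<kappa> p w p \<and> (\<forall>a\<in>lbl ` set w. par \<kappa> a \<longleftrightarrow> a \<in> S)"
        unfolding mem turns_def by (intro exI[of _ \<kappa>]) auto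
    qed
  next
    assume planar: "planar w"
    have "(S, p) \<in> turns ` face_colourings w" if "S \<subseteq> lbl ` set w" for S p
    proof -
      obtain \<kappa> where \<kappa>: "walk \<kappa> p w p" "\<forall>a\<in>lbl ` set w. par \<kappa> a \<longleftrightarrow> a \<in> S"
        using planar unfolding planar_def by blast
      define \<kappa>' where "\<kappa>' a = (if a \<in> lbl ` set w then \<kappa> a else (\<lambda>_ _. False))" for a
      have walk: "walk \<kappa>' p w p"
        using \<kappa>(1) walk_cong[of w \<kappa> \<kappa>' p p] unfolding \<kappa>'_def by simp
      then have p: "p = inc \<kappa>' (hd w)"
        using False by (cases w) auto
      have "par \<kappa>' a \<longleftrightarrow> a \<in> S" if "a \<in> lbl ` set w" for a
        using \<kappa>(2) that par_cong[of \<kappa> a \<kappa>'] by (auto simp: \<kappa>'_def)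
      then have "turns \<kappa>' = (S, p)"
        unfolding turns_def using \<open>S \<subseteq> lbl ` set w\<close> p by auto
      moreover have "\<kappa>' \<in> face_colourings w"
        unfolding mem using walk p by (simp add: \<kappa>'_def)
      ultimately show ?thesis
        by force
    qed
    with sub show "turns ` face_colourings w = ?T"
      by auto
  qed
  finally show ?thesis .
qed

section \<open>Planarity under Reidemeister moves\<close>

declare split_paired_Ex [simp del] split_paired_All [simp del]

lemma walk_complement:
  "walk \<kappa> p w q \<Longrightarrow> walk (\<lambda>a h k. \<not> \<kappa> a h k) (\<not> fst p, \<not> snd p) w (\<not> fst q, \<not> snd q)"
proof (induction w arbitrary: p)
  case (Cons x w)
  then show ?case
    using Cons.IH[of "outc \<kappa> x"] by (cases "eps x") (auto simp: inc_def outc_def Let_def)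
qed simp

lemma planar_rotate1:
  assumes "planar (x # u)"
  shows "planar (u @ [x])"
  unfolding planar_def
proof (intro allI)
  fix S q
  \<comment> \<open>The status of the edge before \<open>x\<close> is chosen so that the edge after
    \<open>x\<close> gets that of \<open>q\<close>. Its colours are then those of \<open>q\<close>
    or both opposite, and complementing all faces settles the second case.\<close>
  define p where "p = (False, turn q \<noteq> (lbl x \<in> S))"
  obtain \<kappa> where \<kappa>: "walk \<kappa> p (x # u) p" "\<forall>a\<in>lbl ` set (x # u). par \<kappa> a \<longleftrightarrow> a \<in> S"
    using assms unfolding planar_def by blast
  then have w: "walk \<kappa> (outc \<kappa> x) (u @ [x]) (outc \<kappa> x)"
    by simp
  have "turn (outc \<kappa> x) = turn q"
    unfolding turn_outc using \<kappa> by (simp add: p_def) blast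
  then consider "outc \<kappa> x = q" | "(\<not> fst (outc \<kappa> x), \<not> snd (outc \<kappa> x)) = q"
    by (cases q) (auto simp: prod_eq_iff)
  then show "\<exists>\<kappa>. walk \<kappa> q (u @ [x]) q \<and> (\<forall>a\<in>lbl ` set (u @ [x]). par \<kappa> a \<longleftrightarrow> a \<in> S)"
  proof cases
    case 1
    with w \<kappa>(2) show ?thesis
      by (intro exI[of _ \<kappa>]) simp
  next
    case 2
    have "par (\<lambda>a h k. \<not> \<kappa> a h k) a = par \<kappa> a" for a
      by (simp add: par_def)
    with walk_complement[OF w] \<kappa>(2) show ?thesis
      unfolding 2 by (intro exI[of _ "\<lambda>a h k. \<not> \<kappa> a h k"]) simp
  qed
qed

lemma planar_rotate: "planar (u @ v) \<Longrightarrow> planar (v @ u)"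
proof (induction u arbitrary: v)
  case (Cons x u)
  then have "planar ((u @ v) @ [x])"
    using planar_rotate1[of x "u @ v"] by simp
  with Cons.IH[of "v @ [x]"] show ?case
    by simp
qed simp

text \<open>The two quadrants adjacent to the monogon belong to one face, so the edges before and
  after the kink see the same pair.\<close>

lemma walk_R1: "walk \<kappa> p [x, mate x] q \<Longrightarrow> p = q"
  by (cases "eps x") (auto simp: inc_def outc_def Let_def)

lemma planar_R1:
  assumes "planar (u @ [x, mate x] @ v)"
  shows "planar (u @ v)"
  unfolding planar_def
proof (intro allI)
  fix S p
  obtain \<kappa> where \<kappa>: "walk \<kappa> p (u @ [x, mate x] @ v) p"
      "\<forall>a\<in>lbl ` set (u @ [x, mate x] @ v). par \<kappa> a \<longleftrightarrow> a \<in> S"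
    using assms unfolding planar_def by blast
  obtain r r' where "walk \<kappa> p u r" "walk \<kappa> r [x, mate x] r'" "walk \<kappa> r' v p"
    using \<kappa>(1) unfolding walk_append by blast
  then have "walk \<kappa> p (u @ v) p"
    using walk_R1[of \<kappa> r x r'] by auto
  with \<kappa>(2) show "\<exists>\<kappa>. walk \<kappa> p (u @ v) p \<and> (\<forall>a\<in>lbl ` set (u @ v). par \<kappa> a \<longleftrightarrow> a \<in> S)"
    by (intro exI[of _ \<kappa>]) auto
qed

text \<open>Going straight through a crossing flips both colours exactly if the other strand lies on
  the boundary there. That strand does not turn between the two crossings, so the colours flip at
  both or at neither.\<close>

lemma walk_R2:
  assumes "eps y \<longleftrightarrow> \<not> eps x" "\<not> par \<kappa> (lbl x)" "\<not> par \<kappa> (lbl y)"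
    and "walk \<kappa> p [x, y] q" "walk \<kappa> p' z q'" "z = [mate x, mate y] \<or> z = [mate y, mate x]"
  shows "p = q" "p' = q'"
  using assms by (cases "eps x"; auto simp: inc_def outc_def par_def Let_def)+

lemma planar_R2:
  assumes planar: "planar (u @ [x, y] @ v @ z @ t)" and z: "z = [mate x, mate y] \<or> z = [mate y, mate x]"
    and eps: "eps y \<longleftrightarrow> \<not> eps x" and fresh: "lbl x \<notin> lbl ` set (u @ v @ t)" "lbl y \<notin> lbl ` set (u @ v @ t)"
  shows "planar (u @ v @ t)"
  unfolding planar_def
proof (intro allI)
  fix S p
  \<comment> \<open>The crossings to be deleted are taken out of \<open>S\<close>, so that the cycle
    goes straight through both as \<open>walk_R2\<close> requires.\<close>
  obtain \<kappa> where \<kappa>: "walk \<kappa> p (u @ [x, y] @ v @ z @ t) p"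
      "\<forall>a\<in>lbl ` set (u @ [x, y] @ v @ z @ t). par \<kappa> a \<longleftrightarrow> a \<in> S - {lbl x, lbl y}"
    using planar unfolding planar_def by blast
  obtain r r' s s' where w: "walk \<kappa> p u r" "walk \<kappa> r [x, y] r'" "walk \<kappa> r' v s" "walk \<kappa> s z s'" "walk \<kappa> s' t p"
    using \<kappa>(1) unfolding walk_append by blast
  have "\<not> par \<kappa> (lbl x)" "\<not> par \<kappa> (lbl y)"
    using \<kappa>(2) by auto
  then have "r = r'" "s = s'"
    using walk_R2[OF eps _ _ w(2) w(4) z] by blast+
  then have "walk \<kappa> p (u @ v @ t) p"
    using w by auto
  moreover have "\<forall>a\<in>lbl ` set (u @ v @ t). par \<kappa> a \<longleftrightarrow> a \<in> S"
  proof
    fix a assume a: "a \<in> lbl ` set (u @ v @ t)"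
    then have "a \<noteq> lbl x" "a \<noteq> lbl y"
      using fresh by blast+
    moreover have "a \<in> lbl ` set (u @ [x, y] @ v @ z @ t)"
      using a by (simp add: image_Un) blast
    ultimately show "par \<kappa> a \<longleftrightarrow> a \<in> S"
      using \<kappa>(2) by blast
  qed
  ultimately show "\<exists>\<kappa>. walk \<kappa> p (u @ v @ t) p \<and> (\<forall>a\<in>lbl ` set (u @ v @ t). par \<kappa> a \<longleftrightarrow> a \<in> S)"
    by blast
qed

text \<open>The faces around a triangle are given by the sides of the three strands on which they lie. Seven of
the eight patterns occur, and the triangles before and after the move have opposite patterns.
Here \<open>ct\<close>, \<open>cm\<close>, \<open>cb\<close> say whether the old triangle is to the left of the top, middle, bottom strand;
the new triangle gets the colour \<open>z\<close> that keeps the parities.\<close>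

lemma walk_R3:
  fixes t m b sp sq sr :: bool and p q r :: nat
  assumes dist: "p \<noteq> q" "p \<noteq> r" "q \<noteq> r"
    and signs: "(sp \<noteq> sq) = (m \<noteq> b)" "(sq \<noteq> sr) = (t \<noteq> m)"
    and T: "walk \<kappa> a (r3_top t p q sp sq) a'"
    and M: "walk \<kappa> c (r3_mid m p r sp sr) c'"
    and B: "walk \<kappa> d (r3_bot b q r sq sr) d'"
  obtains \<kappa>' where "walk \<kappa>' a (r3_top (\<not> t) p q sp sq) a'"
    "walk \<kappa>' c (r3_mid (\<not> m) p r sp sr) c'" "walk \<kappa>' d (r3_bot (\<not> b) q r sq sr) d'"
    "\<And>x. par \<kappa>' x = par \<kappa> x" "\<And>x. x \<notin> {p, q, r} \<Longrightarrow> \<kappa>' x = \<kappa> x"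
proof -
  define ct cm cb where "ct = (m = sp)" "cm = (t \<noteq> sp)" "cb = (t = sq)"
  \<comment> \<open>Colours at a crossing indexed by the sides of its strands, the higher strand
    first. The over-strand has \<open>eps\<close> exactly at a positive crossing, hence the swap of
    arguments.\<close>
  define P where "P i j = (if sp then \<kappa> p i j else \<kappa> p j i)" for i j
  define Q where "Q i l = (if sq then \<kappa> q i l else \<kappa> q l i)" for i l
  define R where "R j l = (if sr then \<kappa> r j l else \<kappa> r l j)" for j l
  define z where "z = (par \<kappa> p \<noteq> ((Q ct (\<not> cb) \<noteq> Q (\<not> ct) (\<not> cb)) \<noteq> R (\<not> cm) (\<not> cb)))"
  \<comment> \<open>At the new \<open>p\<close> the bottom strand passes on the other side, so the
    quadrant \<open>(i, j)\<close> lies in the face \<open>(i, j, \<not> cb)\<close>. Unless this is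
    the new triangle, it has a corner at the old \<open>q\<close> or \<open>r\<close>, where its
    colour is read off. \<open>Q'\<close> and \<open>R'\<close> arise in the same way.\<close>
  define P' where "P' i j = (if i \<noteq> ct \<and> j \<noteq> cm then z else if j = cm then Q i (\<not> cb) else R j (\<not> cb))" for i j
  define Q' where "Q' i l = (if i \<noteq> ct \<and> l \<noteq> cb then z else if l = cb then P i (\<not> cm) else R (\<not> cm) l)" for i l
  define R' where "R' j l = (if j \<noteq> cm \<and> l \<noteq> cb then z else if l = cb then P (\<not> ct) j else Q (\<not> ct) l)" for j l
  define \<kappa>' where "\<kappa>' = \<kappa>(p := \<lambda>h k. if sp then P' h k else P' k h,
    q := \<lambda>h k. if sq then Q' h k else Q' k h, r := \<lambda>h k. if sr then R' h k else R' k h)"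
  have \<kappa>': "\<kappa>' p = (\<lambda>h k. if sp then P' h k else P' k h)" "\<kappa>' q = (\<lambda>h k. if sq then Q' h k else Q' k h)"
    "\<kappa>' r = (\<lambda>h k. if sr then R' h k else R' k h)" "\<And>x. x \<notin> {p, q, r} \<Longrightarrow> \<kappa>' x = \<kappa> x"
    using dist by (auto simp: \<kappa>'_def)
  note defs = ct_cm_cb_def P_def Q_def R_def z_def P'_def Q'_def R'_def
  note simps = r3_top_def r3_mid_def r3_bot_def inc_def outc_def eps_def lbl_def is_over_def is_pos_def Let_def
  have "walk \<kappa>' a (r3_top (\<not> t) p q sp sq) a'"
    "walk \<kappa>' c (r3_mid (\<not> m) p r sp sr) c'" "walk \<kappa>' d (r3_bot (\<not> b) q r sq sr) d'"
    using signs T M B by (cases sp; cases t; cases m; cases b; simp add: simps \<kappa>' defs; fail)+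
  moreover have "par \<kappa>' p = par \<kappa> p" "par \<kappa>' q = par \<kappa> q" "par \<kappa>' r = par \<kappa> r"
    using signs T M B by (cases sp; cases t; cases m; cases b; simp add: simps \<kappa>' defs par_def; auto)+
  moreover have "par \<kappa>' x = par \<kappa> x" if "x \<notin> {p, q, r}" for x
    using \<kappa>'(4)[OF that] by (rule par_cong)
  ultimately show ?thesis
    by (intro that[of \<kappa>'] \<kappa>'(4)) (metis insertE empty_iff)+
qed


text \<open>Pushing the strand through \<open>C\<close> across the other strand through \<open>D\<close> creates a triangle
with corners \<open>C\<close>, \<open>D\<close>, \<open>X\<close> and a bigon with corners \<open>X\<close>, \<open>Y\<close>. Adding these faces to a cycle
makes it turn or not turn at \<open>X\<close> and \<open>Y\<close> as prescribed.\<close>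

lemma walk_R2_create:
  fixes C D X Y :: letter and \<xi> \<eta> :: bool
  assumes dist: "distinct [lbl C, lbl D, lbl X, lbl Y]"
    and eps: "eps X \<longleftrightarrow> \<not> eps C" "eps Y \<longleftrightarrow> eps C"
    and L: "walk \<kappa> a [C] a'" and M: "walk \<kappa> b [mate C, D] b'" and N: "walk \<kappa> c [mate D] c'"
  obtains \<kappa>' where "walk \<kappa>' a (if eps C \<noteq> eps D then [C, X, Y] else [Y, X, C]) a'"
    "walk \<kappa>' b [mate C, D] b'" "walk \<kappa>' c [mate D, mate X, mate Y] c'"
    "par \<kappa>' (lbl X) = \<xi>" "par \<kappa>' (lbl Y) = \<eta>"
    "par \<kappa>' (lbl C) = (par \<kappa> (lbl C) \<noteq> (\<xi> \<noteq> \<eta>))" "par \<kappa>' (lbl D) = (par \<kappa> (lbl D) \<noteq> (\<xi> \<noteq> \<eta>))"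
    "\<And>x. x \<notin> {lbl C, lbl D, lbl X, lbl Y} \<Longrightarrow> \<kappa>' x = \<kappa> x"
proof -
  \<comment> \<open>Side \<open>i\<close> of the strand through \<open>C\<close> is where
    \<open>mate C\<close> leaves, side \<open>j\<close> of \<open>D\<close> where
    \<open>mate D\<close> leaves. So \<phi> is the face into which the strand is pushed, \<rho> the
    one it comes from, and \<psi> the one beyond the strand of \<open>mate D\<close>. Only the
    triangle and the bigon are new; the parities \<xi> and \<eta> are two equations for their
    colours \<open>tri\<close> and \<open>big\<close>.\<close>
  define i j where "i = eps C" "j = eps D"
  define \<phi> \<psi> \<rho> where "\<phi> = (if i then \<kappa> (lbl C) i j else \<kappa> (lbl C) j i)"
    "\<psi> = (if j then \<kappa> (lbl D) j (\<not> j) else \<kappa> (lbl D) (\<not> j) j)"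
    "\<rho> = (if i then \<kappa> (lbl C) (\<not> i) j else \<kappa> (lbl C) j (\<not> i))"
  define tri big where "tri = (\<phi> \<noteq> (\<xi> \<noteq> \<eta>))" "big = ((\<rho> \<noteq> \<phi>) \<noteq> (\<psi> \<noteq> \<eta>))"
  define qX where "qX h k = (if h = i then if k = j then tri else \<psi> else if k = j then \<rho> else big)" for h k
  define qY where "qY h k = (if h = i then if k = j then \<phi> else \<psi> else if k = j then \<rho> else big)" for h k
  define \<kappa>' where "\<kappa>' = \<kappa>(
    lbl C := \<lambda>h k. \<kappa> (lbl C) h k \<noteq> ((if i then h = i \<and> k = j else k = i \<and> h = j) \<and> \<xi> \<noteq> \<eta>),
    lbl D := \<lambda>h k. \<kappa> (lbl D) h k \<noteq> (h = j \<and> k = j \<and> \<xi> \<noteq> \<eta>),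
    lbl X := \<lambda>h k. if i then qX k h else qX h k,
    lbl Y := \<lambda>h k. if i then qY h k else qY k h)"
  have \<kappa>': "\<kappa>' (lbl C) = (\<lambda>h k. \<kappa> (lbl C) h k \<noteq> ((if i then h = i \<and> k = j else k = i \<and> h = j) \<and> \<xi> \<noteq> \<eta>))"
    "\<kappa>' (lbl D) = (\<lambda>h k. \<kappa> (lbl D) h k \<noteq> (h = j \<and> k = j \<and> \<xi> \<noteq> \<eta>))"
    "\<kappa>' (lbl X) = (\<lambda>h k. if i then qX k h else qX h k)" "\<kappa>' (lbl Y) = (\<lambda>h k. if i then qY h k else qY k h)"
    "\<And>x. x \<notin> {lbl C, lbl D, lbl X, lbl Y} \<Longrightarrow> \<kappa>' x = \<kappa> x"
    using dist by (auto simp: \<kappa>'_def)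
  note defs = i_j_def \<phi>_\<psi>_\<rho>_def tri_big_def qX_def qY_def
  have "walk \<kappa>' a (if eps C \<noteq> eps D then [C, X, Y] else [Y, X, C]) a' \<and>
    walk \<kappa>' b [mate C, D] b' \<and> walk \<kappa>' c [mate D, mate X, mate Y] c'"
    using eps L M N by (cases "eps C"; cases "eps D"; auto simp: inc_def outc_def Let_def \<kappa>' defs)
  moreover have "par \<kappa>' (lbl X) = \<xi>" "par \<kappa>' (lbl Y) = \<eta>"
    "par \<kappa>' (lbl C) = (par \<kappa> (lbl C) \<noteq> (\<xi> \<noteq> \<eta>))" "par \<kappa>' (lbl D) = (par \<kappa> (lbl D) \<noteq> (\<xi> \<noteq> \<eta>))"
    by (cases i; cases j; auto simp: par_def \<kappa>' qX_def qY_def tri_big_def)+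
  ultimately show ?thesis
    using that[of \<kappa>'] \<kappa>'(5) by blast
qed

section \<open>Moves of knot diagrams\<close>

lemma knot_diagram_iff: "knot_diagram w \<longleftrightarrow> wf_gauss w \<and> planar w"
  unfolding knot_diagram_def using classical_iff_planar by blast

lemma knot_diagram_rotate:
  assumes "knot_diagram (u @ v)"
  shows "knot_diagram (v @ u)"
proof -
  have "wf_gauss (v @ u)"
    using assms wf_gauss_perm[of "u @ v" "v @ u"] wf_gauss_distinct[of "u @ v"]
    by (simp add: knot_diagram_iff Un_commute Int_commute)
  then show ?thesis
    using assms planar_rotate by (simp add: knot_diagram_iff)
qed

lemma same_diagram_swap: "same_diagram (u @ v) (v @ u)"
proof -
  have "v @ u = map (\<lambda>(a, ov, s). (id a, ov, s)) (rotate (length u) (u @ v))"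
    by (simp add: rotate_append case_prod_beta)
  then show ?thesis
    unfolding same_diagram_def by (intro exI[of _ "length u"] exI[of _ id]) simp
qed

text \<open>Lets a move be checked from a base point at which its pattern matches.\<close>

lemma reidemeister_moveI:
  assumes "knot_diagram (u @ v)" "knot_diagram (u' @ v')" "basic_move (v @ u) (v' @ u')"
  shows "reidemeister_move (u @ v) (u' @ v')"
  unfolding reidemeister_move_def using assms same_diagram_swap by blast

lemma wf_gauss_remove:
  assumes wf: "wf_gauss w" and w': "distinct w'" "set w' = {x\<in>set w. lbl x \<notin> Z}"
  shows "wf_gauss w'"
proof (rule wf_gaussI)
  show "mate x \<in> set w'" if "x \<in> set w'" for x
    using that wf_gauss_mate[OF wf, of x] unfolding w'(2) by simp
  show "y = x \<or> y = mate x" if "x \<in> set w'" "y \<in> set w'" "lbl y = lbl x" for x y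
    using that wf_gauss_same_lbl[OF wf, of x y] unfolding w'(2) by simp
qed (rule w')

lemma wf_gauss_insert:
  assumes wf: "wf_gauss w" and w': "distinct w'" "set w' = {x, mate x, y, mate y} \<union> set w"
    and fresh: "lbl x \<notin> lbl ` set w" "lbl y \<notin> lbl ` set w" "lbl x \<noteq> lbl y"
  shows "wf_gauss w'"
proof (rule wf_gaussI)
  show "mate z \<in> set w'" if "z \<in> set w'" for z
    using that wf_gauss_mate[OF wf, of z] unfolding w'(2) by force
  have eq: "lbl z \<noteq> lbl x" "lbl z \<noteq> lbl y" if "z \<in> set w" for z
    using fresh that by (metis imageI)+
  show "z' = z \<or> z' = mate z" if "z \<in> set w'" "z' \<in> set w'" "lbl z' = lbl z" for z z'
  proof (cases "z \<in> set w")
    case True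
    then have "z' \<in> set w"
      using that eq[of z] unfolding w'(2) by (elim UnE insertE) simp_all
    with True show ?thesis
      using wf_gauss_same_lbl[OF wf] that by blast
  next
    case False
    then have z: "z \<in> {x, mate x, y, mate y}"
      using that unfolding w'(2) by blast
    then have "z' \<notin> set w"
      using eq[of z'] that by auto
    then have "z' \<in> {x, mate x, y, mate y}"
      using that unfolding w'(2) by blast
    with z that(3) fresh(3) show ?thesis
      by (elim insertE emptyE) simp_all
  qed
qed (rule w')

lemma R1_move:
  assumes kd: "knot_diagram (x # mate x # w)"
  shows "reidemeister_move (x # mate x # w) w"
proof -
  have wf: "wf_gauss (x # mate x # w)" and planar: "planar ([] @ [x, mate x] @ w)"
    using kd by (simp_all add: knot_diagram_iff)
  have ne: "lbl z \<noteq> lbl x" if "z \<in> set w" for z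
    using wf_gauss_same_lbl[OF wf, of x z] wf_gauss_distinct[OF wf] that by auto
  have "wf_gauss w"
    using wf_gauss_distinct[OF wf] ne by (intro wf_gauss_remove[OF wf, of w "{lbl x}"]) auto
  then have "knot_diagram ([] @ w)"
    using planar_R1[OF planar] by (simp add: knot_diagram_iff)
  moreover have "R1 (x # mate x # w) w"
    unfolding R1_def mate_def
    by (intro exI[of _ "[]"] exI[of _ w] exI[of _ "lbl x"] exI[of _ "is_over x"] exI[of _ "is_pos x"])
      (simp add: lbl_def is_over_def is_pos_def)
  ultimately show ?thesis
    using reidemeister_moveI[of "[]" "x # mate x # w" "[]" w] kd by (simp add: basic_move_def)
qed

lemma letter_eq: "(lbl x, is_over x, is_pos x) = x"
  by (simp add: lbl_def is_over_def is_pos_def)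

lemma R2_removeI:
  assumes "is_over y = is_over x" "is_pos y \<longleftrightarrow> \<not> is_pos x" "z = [mate x, mate y] \<or> z = [mate y, mate x]"
  shows "R2 (u @ [x, y] @ v @ z @ t) (u @ v @ t)"
proof -
  have *: "(lbl x, is_over x, is_pos x) = x" "(lbl y, is_over x, \<not> is_pos x) = y"
    "(lbl x, \<not> is_over x, is_pos x) = mate x" "(lbl y, \<not> is_over x, \<not> is_pos x) = mate y"
    using assms(1,2) letter_eq[of x] letter_eq[of y] by (simp_all add: mate_def)
  show ?thesis
    unfolding R2_def using assms(3)
    by (intro exI[of _ u] exI[of _ v] exI[of _ t] exI[of _ "lbl x"] exI[of _ "lbl y"]
      exI[of _ "is_over x"] exI[of _ "is_pos x"]) (simp only: *, blast)
qed

lemma R2_move: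
  assumes kd: "knot_diagram (u @ [x, y] @ v @ z @ t)" and z: "z = [mate x, mate y] \<or> z = [mate y, mate x]"
    and xy: "is_over y = is_over x" "is_pos y \<longleftrightarrow> \<not> is_pos x"
  shows "reidemeister_move (u @ [x, y] @ v @ z @ t) (u @ v @ t)"
proof -
  let ?w = "u @ [x, y] @ v @ z @ t"
  have wf: "wf_gauss ?w" and planar: "planar ?w"
    using kd by (simp_all add: knot_diagram_iff)
  have dist: "distinct ?w"
    using wf by (rule wf_gauss_distinct)
  have mem: "x \<in> set ?w" "y \<in> set ?w" "mate x \<in> set z" "mate y \<in> set z"
    using z by auto
  have ne: "lbl a \<noteq> lbl x" "lbl a \<noteq> lbl y" if "a \<in> set (u @ v @ t)" for a
  proof -
    have "a \<in> set ?w" "a \<noteq> x" "a \<noteq> y" "a \<notin> set z"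
      using that dist by auto
    then show "lbl a \<noteq> lbl x" "lbl a \<noteq> lbl y"
      using wf_gauss_same_lbl[OF wf mem(1), of a] wf_gauss_same_lbl[OF wf mem(2), of a] mem by metis+
  qed
  have "set z \<subseteq> {mate x, mate y}"
    using z by auto
  then have z_lbl: "lbl a \<in> {lbl x, lbl y}" if "a \<in> set z" for a
    using that by auto
  have "wf_gauss (u @ v @ t)"
  proof (rule wf_gauss_remove[OF wf])
    show "distinct (u @ v @ t)"
      using dist by auto
    show "set (u @ v @ t) = {a \<in> set ?w. lbl a \<notin> {lbl x, lbl y}}"
      using ne z_lbl by (intro set_eqI) (simp, blast)
  qed
  moreover have "planar (u @ v @ t)"
  proof (rule planar_R2[OF planar z])
    show "eps y \<longleftrightarrow> \<not> eps x"
      using xy by (simp add: eps_def)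
    show "lbl x \<notin> lbl ` set (u @ v @ t)" "lbl y \<notin> lbl ` set (u @ v @ t)"
      using ne by (metis imageE)+
  qed
  ultimately have "knot_diagram (u @ v @ t)"
    by (simp add: knot_diagram_iff)
  then show ?thesis
    using reidemeister_moveI[of "[]" ?w "[]" "u @ v @ t"] kd R2_removeI[OF xy z]
    by (simp add: basic_move_def)
qed

lemma knot_diagram_R3:
  assumes R3: "R3 w w'" and kd: "knot_diagram w"
  shows "knot_diagram w'"
proof -
  have wf: "wf_gauss w" and planar: "planar w"
    using kd by (simp_all add: knot_diagram_iff)
  obtain u v y z t m b p q r sp sq sr where signs: "(sp \<noteq> sq) = (m \<noteq> b)" "(sq \<noteq> sr) = (t \<noteq> m)"
    and w: "w = u @ r3_top t p q sp sq @ v @ r3_mid m p r sp sr @ y @ r3_bot b q r sq sr @ z \<and>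
        w' = u @ r3_top (\<not> t) p q sp sq @ v @ r3_mid (\<not> m) p r sp sr @ y @ r3_bot (\<not> b) q r sq sr @ z \<or>
       w = u @ r3_top t p q sp sq @ v @ r3_bot b q r sq sr @ y @ r3_mid m p r sp sr @ z \<and>
        w' = u @ r3_top (\<not> t) p q sp sq @ v @ r3_bot (\<not> b) q r sq sr @ y @ r3_mid (\<not> m) p r sp sr @ z"
    using R3 unfolding R3_def by (elim exE conjE) (rule that)
  have sets: "set (r3_top t' p q sp sq) = {(p, True, sp), (q, True, sq)}"
    "set (r3_mid t' p r sp sr) = {(p, False, sp), (r, True, sr)}"
    "set (r3_bot t' q r sq sr) = {(q, False, sq), (r, False, sr)}" for t'
    by (auto simp: r3_top_def r3_mid_def r3_bot_def)
  have dists: "distinct (r3_top t' p q sp sq) \<longleftrightarrow> (p, sp) \<noteq> (q, sq)"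
    "distinct (r3_mid t' p r sp sr)"
    "distinct (r3_bot t' q r sq sr) \<longleftrightarrow> (q, sq) \<noteq> (r, sr)" for t'
    by (auto simp: r3_top_def r3_mid_def r3_bot_def)
  have dist: "distinct w"
    using wf by (rule wf_gauss_distinct)
  have set_eq: "set w' = set w"
    using w by (elim disjE conjE) (simp_all only: set_append sets)
  moreover have "distinct w' = distinct w"
    using w by (elim disjE conjE) (simp_all only: distinct_append dists sets set_append)
  ultimately have wf': "wf_gauss w'"
    using wf_gauss_perm[OF wf, of w'] dist by simp
  have mem: "(p, True, sp) \<in> set w" "(q, True, sq) \<in> set w" "(r, True, sr) \<in> set w" 
    using w by (elim disjE conjE; simp add: sets)+
  have "distinct (r3_top t p q sp sq)" "set (r3_top t p q sp sq) \<inter> set (r3_mid m p r sp sr) = {}"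
    using w dist by (elim disjE conjE; hypsubst; unfold distinct_append set_append; blast)+
  then have neq: "(p, True, sp) \<noteq> (q, True, sq)" "(p, True, sp) \<noteq> (r, True, sr)" "(q, True, sq) \<noteq> (r, True, sr)"
    unfolding sets dists by simp_all
  have inj: "a \<noteq> a'" if "(a, True, s) \<in> set w" "(a', True, s') \<in> set w" "(a, True, s) \<noteq> (a', True, s')" for a a' s s'
    using wf_gauss_same_lbl[OF wf that(1,2)] that(3) by (auto simp: mate_def lbl_def is_over_def)
  have pqr: "p \<noteq> q" "p \<noteq> r" "q \<noteq> r"
    using inj mem neq by blast+
  have disj: "(set (r3_top t p q sp sq) \<union> set (r3_mid m p r sp sr) \<union> set (r3_bot b q r sq sr)) \<inter>
      (set u \<union> set v \<union> set y \<union> set z) = {}" and sub: "set u \<union> set v \<union> set y \<union> set z \<subseteq> set w"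
    using w dist by (elim disjE conjE; hypsubst; unfold distinct_append set_append; blast)+
  have fresh: "lbl a \<notin> {p, q, r}" if a: "a \<in> set u \<union> set v \<union> set y \<union> set z" for a
  proof
    assume "lbl a \<in> {p, q, r}"
    then have "\<exists>c\<in>{(p, True, sp), (q, True, sq), (r, True, sr)}. lbl a = lbl c"
      by (simp add: lbl_def)
    then obtain c where c: "c \<in> {(p, True, sp), (q, True, sq), (r, True, sr)}" "lbl a = lbl c"
      by (elim bexE) (rule that)
    have "c \<in> set w"
      using c(1) mem by blast
    then have "a = c \<or> a = mate c"
      using wf_gauss_same_lbl[OF wf _ _ c(2)] sub a by blast
    moreover have "mate c \<in> {(p, False, sp), (q, False, sq), (r, False, sr)}"
      using c(1) by (elim insertE emptyE) (simp_all add: mate_def lbl_def is_over_def is_pos_def)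
    ultimately show False
      using c(1) disj a unfolding sets by blast
  qed
  have new: "\<exists>\<kappa>'. walk \<kappa>' a (r3_top (\<not> t) p q sp sq) a' \<and> walk \<kappa>' c (r3_mid (\<not> m) p r sp sr) c' \<and>
      walk \<kappa>' d (r3_bot (\<not> b) q r sq sr) d' \<and> (\<forall>x. par \<kappa>' x = par \<kappa> x) \<and>
      (\<forall>f x g. x \<in> {u, v, y, z} \<longrightarrow> walk \<kappa> f x g \<longrightarrow> walk \<kappa>' f x g)"
    if TMB: "walk \<kappa> a (r3_top t p q sp sq) a'" "walk \<kappa> c (r3_mid m p r sp sr) c'"
      "walk \<kappa> d (r3_bot b q r sq sr) d'" for \<kappa> a a' c c' d d'
  proof -
    obtain \<kappa>' where \<kappa>': "walk \<kappa>' a (r3_top (\<not> t) p q sp sq) a'"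
      "walk \<kappa>' c (r3_mid (\<not> m) p r sp sr) c'" "walk \<kappa>' d (r3_bot (\<not> b) q r sq sr) d'"
      "\<And>x. par \<kappa>' x = par \<kappa> x" "\<And>x. x \<notin> {p, q, r} \<Longrightarrow> \<kappa>' x = \<kappa> x"
      by (rule walk_R3[OF pqr signs TMB]) (rule that)
    have "walk \<kappa>' f x g" if "x \<in> {u, v, y, z}" "walk \<kappa> f x g" for f x g
    proof -
      have "\<kappa>' a = \<kappa> a" if "a \<in> lbl ` set x" for a
        using \<kappa>'(5)[of a] fresh \<open>x \<in> {u, v, y, z}\<close> that by blast
      then show ?thesis
        using walk_cong[of x \<kappa>' \<kappa>] that(2) by blast
    qed
    with \<kappa>' show ?thesis
      by blast
  qed
  have "planar w'"
    unfolding planar_def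
  proof (intro allI)
    fix S e
    obtain \<kappa> where \<kappa>: "walk \<kappa> e w e" "\<forall>a\<in>lbl ` set w. par \<kappa> a \<longleftrightarrow> a \<in> S"
      using planar unfolding planar_def by blast
    have "\<exists>\<kappa>'. walk \<kappa>' e w' e \<and> (\<forall>a. par \<kappa>' a = par \<kappa> a)"
      using w
    proof (elim disjE conjE)
      assume w: "w = u @ r3_top t p q sp sq @ v @ r3_mid m p r sp sr @ y @ r3_bot b q r sq sr @ z"
        and w': "w' = u @ r3_top (\<not> t) p q sp sq @ v @ r3_mid (\<not> m) p r sp sr @ y @ r3_bot (\<not> b) q r sq sr @ z"
      obtain a a' c c' d d' where
        rest: "walk \<kappa> e u a" "walk \<kappa> a' v c" "walk \<kappa> c' y d" "walk \<kappa> d' z e" and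
        TMB: "walk \<kappa> a (r3_top t p q sp sq) a'" "walk \<kappa> c (r3_mid m p r sp sr) c'"
        "walk \<kappa> d (r3_bot b q r sq sr) d'"
        using \<kappa>(1) unfolding w walk_append by blast
      obtain \<kappa>' where \<kappa>': "walk \<kappa>' a (r3_top (\<not> t) p q sp sq) a'"
        "walk \<kappa>' c (r3_mid (\<not> m) p r sp sr) c'" "walk \<kappa>' d (r3_bot (\<not> b) q r sq sr) d'"
        "\<forall>x. par \<kappa>' x = par \<kappa> x"
        and all: "\<forall>f x g. x \<in> {u, v, y, z} \<longrightarrow> walk \<kappa> f x g \<longrightarrow> walk \<kappa>' f x g"
        using new[OF TMB] by (elim exE conjE) (rule that)
      have "walk \<kappa>' e u a" "walk \<kappa>' a' v c" "walk \<kappa>' c' y d" "walk \<kappa>' d' z e"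
        using all rest by simp_all
      with \<kappa>' show ?thesis
        unfolding w' walk_append by blast
    next
      assume w: "w = u @ r3_top t p q sp sq @ v @ r3_bot b q r sq sr @ y @ r3_mid m p r sp sr @ z"
        and w': "w' = u @ r3_top (\<not> t) p q sp sq @ v @ r3_bot (\<not> b) q r sq sr @ y @ r3_mid (\<not> m) p r sp sr @ z"
      obtain a a' c c' d d' where
        rest: "walk \<kappa> e u a" "walk \<kappa> a' v d" "walk \<kappa> d' y c" "walk \<kappa> c' z e" and
        TMB: "walk \<kappa> a (r3_top t p q sp sq) a'" "walk \<kappa> c (r3_mid m p r sp sr) c'"
        "walk \<kappa> d (r3_bot b q r sq sr) d'"
        using \<kappa>(1) unfolding w walk_append by blast
      obtain \<kappa>' where \<kappa>': "walk \<kappa>' a (r3_top (\<not> t) p q sp sq) a'"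
        "walk \<kappa>' c (r3_mid (\<not> m) p r sp sr) c'" "walk \<kappa>' d (r3_bot (\<not> b) q r sq sr) d'"
        "\<forall>x. par \<kappa>' x = par \<kappa> x"
        and all: "\<forall>f x g. x \<in> {u, v, y, z} \<longrightarrow> walk \<kappa> f x g \<longrightarrow> walk \<kappa>' f x g"
        using new[OF TMB] by (elim exE conjE) (rule that)
      have "walk \<kappa>' e u a" "walk \<kappa>' a' v d" "walk \<kappa>' d' y c" "walk \<kappa>' c' z e"
        using all rest by simp_all
      with \<kappa>' show ?thesis
        unfolding w' walk_append by blast
    qed
    with \<kappa>(2) show "\<exists>\<kappa>. walk \<kappa> e w' e \<and> (\<forall>a\<in>lbl ` set w'. par \<kappa> a \<longleftrightarrow> a \<in> S)"
      unfolding set_eq by blast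
  qed
  with wf' show ?thesis
    by (simp add: knot_diagram_iff)
qed

text \<open>Each pair is one strand before and after the move. Detaching the triangle from its
  position in the word lets \<open>R3_move\<close> treat all orders of the strands along the
  knot.\<close>

definition r3_strands :: "gauss \<times> gauss \<Rightarrow> gauss \<times> gauss \<Rightarrow> gauss \<times> gauss \<Rightarrow> bool" where
  "r3_strands T M B \<longleftrightarrow> (\<exists>t m b p q r sp sq sr. (sp \<noteq> sq) = (m \<noteq> b) \<and> (sq \<noteq> sr) = (t \<noteq> m) \<and>
     T = (r3_top t p q sp sq, r3_top (\<not> t) p q sp sq) \<and>
     M = (r3_mid m p r sp sr, r3_mid (\<not> m) p r sp sr) \<and>
     B = (r3_bot b q r sq sr, r3_bot (\<not> b) q r sq sr))"

lemma R3_move_top_first: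
  assumes kd: "knot_diagram (u @ v)" and tri: "r3_strands T M B"
    and vu: "v @ u = fst T @ x @ fst M @ y @ fst B @ z \<and> v' @ u' = snd T @ x @ snd M @ y @ snd B @ z \<or>
      v @ u = fst T @ x @ fst B @ y @ fst M @ z \<and> v' @ u' = snd T @ x @ snd B @ y @ snd M @ z"
  shows "reidemeister_move (u @ v) (u' @ v')"
proof -
  obtain t m b p q r sp sq sr where signs: "(sp \<noteq> sq) = (m \<noteq> b)" "(sq \<noteq> sr) = (t \<noteq> m)" and
    TMB: "T = (r3_top t p q sp sq, r3_top (\<not> t) p q sp sq)"
    "M = (r3_mid m p r sp sr, r3_mid (\<not> m) p r sp sr)"
    "B = (r3_bot b q r sq sr, r3_bot (\<not> b) q r sq sr)"
    using tri unfolding r3_strands_def by (elim exE conjE) (rule that)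
  have R3: "R3 (v @ u) (v' @ u')"
    unfolding R3_def
    by (rule exI[of _ "[]"], rule exI[of _ x], rule exI[of _ y], rule exI[of _ z], rule exI[of _ t],
      rule exI[of _ m], rule exI[of _ b], rule exI[of _ p], rule exI[of _ q], rule exI[of _ r],
      rule exI[of _ sp], rule exI[of _ sq], rule exI[of _ sr], intro conjI signs,
      unfold append_Nil, rule vu[unfolded TMB fst_conv snd_conv])
  then have "knot_diagram (u' @ v')"
    using knot_diagram_R3 knot_diagram_rotate kd by blast
  with R3 kd show ?thesis
    by (intro reidemeister_moveI) (simp_all add: basic_move_def)
qed

text \<open>\<open>R3\<close> lists the top strand first and allows both orders of the other two;
  shifting the base point brings whichever strand is on top to the front.\<close>

lemma R3_move:
  assumes kd: "knot_diagram (u @ fst P @ v @ fst Q @ y @ fst R @ z)"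
    and tri: "r3_strands P Q R \<or> r3_strands P R Q \<or> r3_strands Q P R \<or> r3_strands Q R P \<or>
      r3_strands R P Q \<or> r3_strands R Q P"
  shows "reidemeister_move (u @ fst P @ v @ fst Q @ y @ fst R @ z) (u @ snd P @ v @ snd Q @ y @ snd R @ z)"
proof -
  consider "r3_strands P Q R \<or> r3_strands P R Q" | "r3_strands Q P R \<or> r3_strands Q R P"
    | "r3_strands R P Q \<or> r3_strands R Q P"
    using tri by blast
  then show ?thesis
  proof cases
    case 1
    then show ?thesis
      using R3_move_top_first[of u "fst P @ v @ fst Q @ y @ fst R @ z" _ _ _ v y "z @ u"
          "snd P @ v @ snd Q @ y @ snd R @ z" u] kd by (elim disjE) simp_all
  next
    case 2
    then show ?thesis
      using R3_move_top_first[of "u @ fst P @ v" "fst Q @ y @ fst R @ z" _ _ _ y "z @ u" v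
          "snd Q @ y @ snd R @ z" "u @ snd P @ v"] kd by (elim disjE) simp_all
  next
    case 3
    then show ?thesis
      using R3_move_top_first[of "u @ fst P @ v @ fst Q @ y" "fst R @ z" _ _ _ "z @ u" v y
          "snd R @ z" "u @ snd P @ v @ snd Q @ y"] kd by (elim disjE) simp_all
  qed
qed

text \<open>The strand \<open>P\<close> passes over both others or under both, so it is top or
  bottom, and \<open>is_over D\<close> ranks the other two. The sign condition holds because
  \<open>C\<close> and \<open>X\<close> have opposite signs and the order within \<open>P\<close>
  follows \<open>eps\<close>.\<close>

lemma r3_strands_push:
  fixes C D X :: letter
  assumes X: "is_over X = is_over C" "is_pos X \<longleftrightarrow> \<not> is_pos C"
  defines "P \<equiv> if eps C \<noteq> eps D then ([C, X], [X, C]) else ([X, C], [C, X])"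
  defines "Q \<equiv> ([mate C, D], [D, mate C])"
  defines "R \<equiv> ([mate D, mate X], [mate X, mate D])"
  shows "r3_strands P Q R \<or> r3_strands P R Q \<or> r3_strands R Q P \<or> r3_strands Q R P"
proof -
  obtain c x d oc sc od sd where [simp]: "C = (c, oc, sc)" "X = (x, oc, \<not> sc)" "D = (d, od, sd)"
    using X by (cases C; cases X; cases D) (auto simp: is_over_def is_pos_def)
  let ?s = "eps C \<noteq> eps D"
  note s = eps_def is_over_def is_pos_def mate_def lbl_def
  note d = r3_strands_def P_def Q_def R_def r3_top_def r3_mid_def r3_bot_def
  consider "oc" "od" | "oc" "\<not> od" | "\<not> oc" "od" | "\<not> oc" "\<not> od"
    by blast
  then show ?thesis
  proof cases
    case 1
    have "r3_strands P Q R"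
      unfolding d by (rule exI[of _ "?s"], rule exI[of _ True], rule exI[of _ False], rule exI[of _ c],
        rule exI[of _ x], rule exI[of _ d], rule exI[of _ sc],
        rule exI[of _ "\<not> sc"], rule exI[of _ sd], auto simp: s 1)
    then show ?thesis
      by blast
  next
    case 2
    have "r3_strands P R Q"
      unfolding d by (rule exI[of _ "\<not> ?s"], rule exI[of _ False], rule exI[of _ True],
        rule exI[of _ x], rule exI[of _ c], rule exI[of _ d],
        rule exI[of _ "\<not> sc"], rule exI[of _ sc], rule exI[of _ sd],
        auto simp: s 2)
    then show ?thesis
      by blast
  next
    case 3
    have "r3_strands Q R P"
      unfolding d by (rule exI[of _ False], rule exI[of _ True], rule exI[of _ "?s"], rule exI[of _ d], rule exI[of _ c], rule exI[of _ x],
        rule exI[of _ sd], rule exI[of _ sc], rule exI[of _ "\<not> sc"],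
        auto simp: s 3)
    then show ?thesis
      by blast
  next
    case 4
    have "r3_strands R Q P"
      unfolding d by (rule exI[of _ True], rule exI[of _ False], rule exI[of _ "\<not> ?s"],
        rule exI[of _ d], rule exI[of _ x], rule exI[of _ c],
        rule exI[of _ sd], rule exI[of _ "\<not> sc"], rule exI[of _ sc],
        auto simp: s 4)
    then show ?thesis
      by blast
  qed
qed

text \<open>\<open>f\<close> tells whether the passage through \<open>mate C\<close> and
  \<open>D\<close> precedes the one through \<open>mate D\<close> along the knot.\<close>

lemma planar_R2_create:
  fixes C D X Y :: letter and f :: bool
  defines "L \<equiv> if eps C \<noteq> eps D then [C, X, Y] else [Y, X, C]"
  defines "s1 \<equiv> if f then [mate C, D] else [mate D]"
  defines "s2 \<equiv> if f then [mate D] else [mate C, D]"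
  defines "s1' \<equiv> if f then [mate C, D] else [mate D, mate X, mate Y]"
  defines "s2' \<equiv> if f then [mate D, mate X, mate Y] else [mate C, D]"
  assumes planar: "planar (u0 @ [C] @ u1 @ s1 @ u2 @ s2 @ u3)"
    and dist: "distinct [lbl C, lbl D, lbl X, lbl Y]"
    and eps: "eps X \<longleftrightarrow> \<not> eps C" "eps Y \<longleftrightarrow> eps C"
    and fresh: "\<And>a. a \<in> set (u0 @ u1 @ u2 @ u3) \<Longrightarrow> lbl a \<notin> {lbl C, lbl D, lbl X, lbl Y}"
  shows "planar (u0 @ L @ u1 @ s1' @ u2 @ s2' @ u3)"
  unfolding planar_def
proof (intro allI)
  fix S p
  define \<xi> \<eta> where "\<xi> = (lbl X \<in> S)" "\<eta> = (lbl Y \<in> S)"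
  \<comment> \<open>Prescribing the turns at \<open>X\<close> and \<open>Y\<close> may add the new
    triangle, which has corners at \<open>C\<close> and \<open>D\<close>; the old cycle compensates
    for this in advance.\<close>
  define S0 where "S0 = {a. (a \<in> S) \<noteq> (a \<in> {lbl C, lbl D} \<and> \<xi> \<noteq> \<eta>)}"
  obtain \<kappa> where \<kappa>: "walk \<kappa> p (u0 @ [C] @ u1 @ s1 @ u2 @ s2 @ u3) p"
      "\<forall>a\<in>lbl ` set (u0 @ [C] @ u1 @ s1 @ u2 @ s2 @ u3). par \<kappa> a \<longleftrightarrow> a \<in> S0"
    using planar unfolding planar_def by blast
  obtain a a' r1 r1' r2 r2' where rest: "walk \<kappa> p u0 a" "walk \<kappa> a' u1 r1" "walk \<kappa> r1' u2 r2" "walk \<kappa> r2' u3 p"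
    and CDD: "walk \<kappa> a [C] a'" "walk \<kappa> r1 s1 r1'" "walk \<kappa> r2 s2 r2'"
    using \<kappa>(1) unfolding walk_append by blast
  define b b' c c' where "b = (if f then r1 else r2)" "b' = (if f then r1' else r2')"
    "c = (if f then r2 else r1)" "c' = (if f then r2' else r1')"
  note bc = b_b'_c_c'_def
  have CD: "walk \<kappa> b [mate C, D] b'" and D: "walk \<kappa> c [mate D] c'"
    using CDD(2,3) unfolding bc s1_def s2_def by (cases f; simp)+
  obtain \<kappa>' where \<kappa>': "walk \<kappa>' a L a'" "walk \<kappa>' b [mate C, D] b'" "walk \<kappa>' c [mate D, mate X, mate Y] c'"
    "par \<kappa>' (lbl X) = \<xi>" "par \<kappa>' (lbl Y) = \<eta>"
    "par \<kappa>' (lbl C) = (par \<kappa> (lbl C) \<noteq> (\<xi> \<noteq> \<eta>))" "par \<kappa>' (lbl D) = (par \<kappa> (lbl D) \<noteq> (\<xi> \<noteq> \<eta>))"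
    and eq: "\<And>x. x \<notin> {lbl C, lbl D, lbl X, lbl Y} \<Longrightarrow> \<kappa>' x = \<kappa> x"
    by (rule walk_R2_create[OF dist eps CDD(1) CD D, where \<xi> = \<xi> and \<eta> = \<eta>, folded L_def]) (rule that)
  have walk: "walk \<kappa>' g v h" if "walk \<kappa> g v h" "set v \<subseteq> set (u0 @ u1 @ u2 @ u3)" for g v h
  proof -
    have "\<kappa>' (lbl a) = \<kappa> (lbl a)" if "a \<in> set v" for a
      by (rule eq, rule fresh, rule subsetD[OF \<open>set v \<subseteq> _\<close> that])
    then have "\<kappa>' a = \<kappa> a" if "a \<in> lbl ` set v" for a
      using that by blast
    with walk_cong[of v \<kappa>' \<kappa> g h] that(1) show ?thesis
      by simp
  qed
  have "walk \<kappa>' r1 s1' r1'" "walk \<kappa>' r2 s2' r2'"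
    using \<kappa>'(2,3) unfolding bc s1'_def s2'_def by (cases f; simp)+
  then have "walk \<kappa>' p (u0 @ L @ u1 @ s1' @ u2 @ s2' @ u3) p"
    unfolding walk_append using \<kappa>'(1) rest[THEN walk] by fastforce
  moreover have "par \<kappa>' a \<longleftrightarrow> a \<in> S" if a: "a \<in> lbl ` set (u0 @ L @ u1 @ s1' @ u2 @ s2' @ u3)" for a
  proof (cases "a \<in> {lbl C, lbl D, lbl X, lbl Y}")
    case True
    have "par \<kappa> (lbl C) \<longleftrightarrow> lbl C \<in> S0"
      using \<kappa>(2) by simp
    moreover have "par \<kappa> (lbl D) \<longleftrightarrow> lbl D \<in> S0"
      using \<kappa>(2) unfolding s1_def s2_def by (cases f) simp_all
    ultimately show ?thesis
      using True \<kappa>'(4-7) unfolding S0_def \<xi>_\<eta>_def by (elim insertE emptyE) auto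
  next
    case False
    have "lbl ` set L \<subseteq> {lbl C, lbl D, lbl X, lbl Y}" "lbl ` set s1' \<subseteq> {lbl C, lbl D, lbl X, lbl Y}"
      "lbl ` set s2' \<subseteq> {lbl C, lbl D, lbl X, lbl Y}"
      unfolding L_def s1'_def s2'_def by simp_all
    with a False have "a \<in> lbl ` set (u0 @ u1 @ u2 @ u3)"
      unfolding set_append image_Un by blast
    then have "par \<kappa> a \<longleftrightarrow> a \<in> S0"
      using \<kappa>(2) unfolding set_append image_Un by blast
    with False show ?thesis
      using par_cong[of \<kappa>' a \<kappa>] eq[OF False] unfolding S0_def by simp
  qed
  ultimately show "\<exists>\<kappa>. walk \<kappa> p (u0 @ L @ u1 @ s1' @ u2 @ s2' @ u3) p \<and>
      (\<forall>a\<in>lbl ` set (u0 @ L @ u1 @ s1' @ u2 @ s2' @ u3). par \<kappa> a \<longleftrightarrow> a \<in> S)"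
    by blast
qed

text \<open>R2 pushes the strand of \<open>C\<close> across that of \<open>mate D\<close> close to
  \<open>D\<close>, which creates the triangle \<open>C\<close>, \<open>D\<close>, \<open>X\<close>;
  R3 on it carries the strand past the crossing \<open>D\<close>. Afterwards the third strand meets
  \<open>D\<close> before it meets the strand of \<open>C\<close>.\<close>

lemma push_move:
  fixes C D X Y :: letter and f :: bool and u0 u1 u2 u3 :: gauss
  defines "s1 \<equiv> if f then [mate C, D] else [mate D]"
  defines "s2 \<equiv> if f then [mate D] else [mate C, D]"
  defines "w \<equiv> u0 @ [C] @ u1 @ s1 @ u2 @ s2 @ u3"
  defines "w' \<equiv> u0 @ (if eps C \<noteq> eps D then [X, C, Y] else [Y, C, X]) @
    u1 @ (if f then [D, mate C] else [mate X, mate D, mate Y]) @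
    u2 @ (if f then [mate X, mate D, mate Y] else [D, mate C]) @ u3"
  assumes kd: "knot_diagram w"
    and CD: "lbl C \<noteq> lbl D" and fresh: "lbl X \<notin> lbl ` set w" "lbl Y \<notin> lbl ` set w" "lbl X \<noteq> lbl Y"
    and X: "is_over X = is_over C" "is_pos X \<longleftrightarrow> \<not> is_pos C"
    and Y: "is_over Y = is_over C" "is_pos Y = is_pos C"
  shows "\<exists>w1. reidemeister_move w w1 \<and> reidemeister_move w1 w'"
proof -
  let ?same = "eps C \<noteq> eps D"
  define L where "L = (if ?same then [C, X, Y] else [Y, X, C])"
  define s1' where "s1' = (if f then [mate C, D] else [mate D, mate X, mate Y])"
  define s2' where "s2' = (if f then [mate D, mate X, mate Y] else [mate C, D])"
  define w1 where "w1 = u0 @ L @ u1 @ s1' @ u2 @ s2' @ u3"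
  have wf: "wf_gauss w" and planar: "planar w"
    using kd by (simp_all add: knot_diagram_iff)
  have dist: "distinct w"
    using wf by (rule wf_gauss_distinct)
  have sets: "set s1 \<union> set s2 = {mate C, D, mate D}" "set s1' \<union> set s2' = {mate C, D, mate D, mate X, mate Y}"
    "set L = {C, X, Y}"
    unfolding s1_def s2_def s1'_def s2'_def L_def by auto
  have set_w: "set w = {C, mate C, D, mate D} \<union> set (u0 @ u1 @ u2 @ u3)"
    unfolding w_def set_append using sets(1) by auto
  have "set w1 = set L \<union> (set s1' \<union> set s2') \<union> set (u0 @ u1 @ u2 @ u3)"
    unfolding w1_def set_append by blast
  then have set_w1: "set w1 = {X, mate X, Y, mate Y} \<union> set w"
    unfolding set_w sets by blast
  have new: "X \<notin> set w" "mate X \<notin> set w" "Y \<notin> set w" "mate Y \<notin> set w" "X \<noteq> Y" "mate X \<noteq> mate Y"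
    "X \<noteq> mate Y" "mate X \<noteq> Y"
    using fresh by (metis imageI lbl_mate)+
  have dist1: "distinct w1"
  proof (rule card_distinct)
    have "length w1 = length w + 4"
      unfolding w_def w1_def L_def s1_def s2_def s1'_def s2'_def by (cases f) simp_all
    moreover have "card (set w1) = card (set w) + 4"
      unfolding set_w1 using new new(5-8)[symmetric] by simp
    ultimately show "card (set w1) = length w1"
      using distinct_card[OF dist] by simp
  qed
  have wf1: "wf_gauss w1"
    using wf dist1 set_w1 fresh by (rule wf_gauss_insert)
  have old: "lbl a \<notin> {lbl C, lbl D, lbl X, lbl Y}" if a: "a \<in> set (u0 @ u1 @ u2 @ u3)" for a
  proof -
    have "a \<in> set w" "C \<in> set w" "D \<in> set w"
      using a unfolding set_w by blast+
    moreover have "a \<notin> {C, mate C, D, mate D}"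
      using a dist unfolding w_def s1_def s2_def by (cases f) (simp_all, blast+)
    ultimately have "lbl a \<noteq> lbl C" "lbl a \<noteq> lbl D"
      using wf_gauss_same_lbl[OF wf] by blast+
    moreover have "lbl a \<noteq> lbl X" "lbl a \<noteq> lbl Y"
      using fresh \<open>a \<in> set w\<close> by (metis imageI)+
    ultimately show ?thesis
      by simp
  qed
  have CDXY: "distinct [lbl C, lbl D, lbl X, lbl Y]"
    using CD fresh unfolding set_w by auto
  have eps: "eps X \<longleftrightarrow> \<not> eps C" "eps Y \<longleftrightarrow> eps C"
    using X Y by (simp_all add: eps_def)
  have "planar w1"
    using planar_R2_create[OF planar[unfolded w_def s1_def s2_def] CDXY eps old]
    unfolding w1_def L_def s1'_def s2'_def .
  with wf1 have kd1: "knot_diagram w1"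
    by (simp add: knot_diagram_iff)
  have "R2 w1 w"
  proof -
    have XY: "R2 (u @ [X, Y] @ v @ [mate X, mate Y] @ t) (u @ v @ t)" for u v t
      using R2_removeI[of Y X "[mate X, mate Y]" u v t] X Y by simp
    have YX: "R2 (u @ [Y, X] @ v @ [mate X, mate Y] @ t) (u @ v @ t)" for u v t
      using R2_removeI[of X Y "[mate X, mate Y]" u v t] X Y by simp
    note defs = w1_def w_def L_def s1_def s2_def s1'_def s2'_def
    show ?thesis
    proof (cases f; cases ?same)
      assume "f" "?same"
      then show ?thesis
        using XY[of "u0 @ [C]" "u1 @ [mate C, D] @ u2 @ [mate D]" u3] unfolding defs by simp
    next
      assume "f" "\<not> ?same"
      then show ?thesis
        using YX[of u0 "[C] @ u1 @ [mate C, D] @ u2 @ [mate D]" u3] unfolding defs by simp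
    next
      assume "\<not> f" "?same"
      then show ?thesis
        using XY[of "u0 @ [C]" "u1 @ [mate D]" "u2 @ [mate C, D] @ u3"] unfolding defs by simp
    next
      assume "\<not> f" "\<not> ?same"
      then show ?thesis
        using YX[of u0 "[C] @ u1 @ [mate D]" "u2 @ [mate C, D] @ u3"] unfolding defs by simp
    qed
  qed
  then have "reidemeister_move w w1"
    using reidemeister_moveI[of "[]" w "[]" w1] kd kd1 by (simp add: basic_move_def)
  moreover have "reidemeister_move w1 w'"
  proof -
    define P where "P = (if ?same then ([C, X], [X, C]) else ([X, C], [C, X]))"
    define Q where "Q = ([mate C, D], [D, mate C])"
    define R where "R = ([mate D, mate X], [mate X, mate D])"
    define pre post where "pre = (if ?same then [] else [Y])" "post = (if ?same then [Y] else [])"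
    have strands: "r3_strands P Q R \<or> r3_strands P R Q \<or> r3_strands R Q P \<or> r3_strands Q R P"
      using r3_strands_push[OF X, of D] unfolding P_def Q_def R_def .
    note defs = w1_def w'_def L_def s1'_def s2'_def P_def Q_def R_def pre_post_def
    show ?thesis
    proof (cases f)
      case True
      have "w1 = (u0 @ pre) @ fst P @ (post @ u1) @ fst Q @ u2 @ fst R @ (mate Y # u3)"
        "w' = (u0 @ pre) @ snd P @ (post @ u1) @ snd Q @ u2 @ snd R @ (mate Y # u3)"
        using True unfolding defs by simp_all
      then show ?thesis
        using R3_move[of "u0 @ pre" P "post @ u1" Q u2 R "mate Y # u3"] kd1 strands by blast
    next
      case False
      have "w1 = (u0 @ pre) @ fst P @ (post @ u1) @ fst R @ (mate Y # u2) @ fst Q @ u3"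
        "w' = (u0 @ pre) @ snd P @ (post @ u1) @ snd R @ (mate Y # u2) @ snd Q @ u3"
        using False unfolding defs by simp_all
      then show ?thesis
        using R3_move[of "u0 @ pre" P "post @ u1" R "mate Y # u2" Q u3] kd1 strands by blast
    qed
  qed
  ultimately show ?thesis
    by blast
qed

section \<open>Shrinking an over- or under-passing loop\<close>

text \<open>The word is read from the crossing \<open>A\<close> at which the loop closes. As all
  passages in \<open>L\<close> are on one level, no crossing occurs twice in \<open>L\<close>, so
  the loop is simple; \<open>M\<close> stays arbitrary so that the state survives the
  pushes.\<close>

definition loop_state :: "bool \<Rightarrow> letter \<Rightarrow> gauss \<Rightarrow> gauss \<Rightarrow> bool" where
  "loop_state ov A L M \<longleftrightarrow> knot_diagram (A # L @ mate A # M) \<and> (\<forall>x\<in>set L. is_over x = ov)"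

text \<open>Walking along \<open>M\<close>, every passage through the loop (labels \<open>Z\<close>) switches between its outside and
its inside, \<open>\<sigma>\<close> being the sign on entering; the remaining crossings inside the loop are those in \<open>I\<close>.\<close>

fun scan :: "nat set \<Rightarrow> nat set \<Rightarrow> bool \<Rightarrow> bool \<Rightarrow> gauss \<Rightarrow> bool \<Rightarrow> bool" where
  "scan Z I \<sigma> b [] b' \<longleftrightarrow> b = b'"
| "scan Z I \<sigma> b (x # w) b' \<longleftrightarrow>
    (if lbl x \<in> Z then (is_pos x \<longleftrightarrow> b \<noteq> \<sigma>) \<and> scan Z I \<sigma> (\<not> b) w b'
     else (lbl x \<in> I \<longleftrightarrow> b) \<and> scan Z I \<sigma> b w b')"

lemma scan_append [simp]:
  "scan Z I \<sigma> b (u @ v) b' \<longleftrightarrow> (\<exists>c. scan Z I \<sigma> b u c \<and> scan Z I \<sigma> c v b')"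
  by (induction u arbitrary: b) auto

lemma scan_cong:
  assumes "\<And>a. a \<in> lbl ` set w \<Longrightarrow> (a \<in> Z \<longleftrightarrow> a \<in> Z') \<and> (a \<in> I \<longleftrightarrow> a \<in> I')"
  shows "scan Z I \<sigma> b w b' = scan Z' I' \<sigma> b w b'"
  using assms
proof (induction w arbitrary: b)
  case (Cons x w)
  have "scan Z I \<sigma> c w b' = scan Z' I' \<sigma> c w b'" for c
    using Cons.IH[of c] Cons.prems by simp
  moreover have "(lbl x \<in> Z \<longleftrightarrow> lbl x \<in> Z') \<and> (lbl x \<in> I \<longleftrightarrow> lbl x \<in> I')"
    using Cons.prems[of "lbl x"] by simp
  ultimately show ?case
    by simp
qed simp

lemma loop_state_wf: "loop_state ov A L M \<Longrightarrow> wf_gauss (A # L @ mate A # M)"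
  by (simp add: loop_state_def knot_diagram_iff)

lemma loop_state_facts:
  assumes st: "loop_state ov A L M"
  shows "x \<in> set L \<Longrightarrow> mate x \<in> set M" "x \<in> set L \<Longrightarrow> is_over x = ov"
    "x \<in> set M \<Longrightarrow> lbl x \<in> lbl ` set L \<Longrightarrow> mate x \<in> set L"
    "x \<in> set M \<Longrightarrow> lbl x \<notin> lbl ` set L \<Longrightarrow> mate x \<in> set M"
    "x \<in> set L \<union> set M \<Longrightarrow> lbl x \<noteq> lbl A"
proof -
  let ?w = "A # L @ mate A # M"
  have wf: "wf_gauss ?w" and over: "\<forall>x\<in>set L. is_over x = ov"
    using st by (simp_all add: loop_state_def knot_diagram_iff)
  have dist: "distinct ?w"
    using wf by (rule wf_gauss_distinct)
  show A: "lbl x \<noteq> lbl A" if "x \<in> set L \<union> set M" for x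
    using wf_gauss_same_lbl[OF wf, of A x] dist that by auto
  have mate: "mate x \<in> set L \<union> set M" if x: "x \<in> set L \<union> set M" for x
  proof -
    have "mate x \<in> set ?w"
      using wf_gauss_mate[OF wf, of x] x by auto
    moreover have "mate x \<noteq> A" "mate x \<noteq> mate A"
      using A[OF x] by (metis lbl_mate)+
    ultimately show ?thesis
      by simp
  qed
  show "is_over x = ov" if "x \<in> set L" for x
    using over that by blast
  show "mate x \<in> set M" if x: "x \<in> set L" for x
  proof -
    have "mate x \<notin> set L"
      using over x is_over_mate by blast
    with mate[of x] x show ?thesis
      by blast
  qed
  show "mate x \<in> set L" if x: "x \<in> set M" "lbl x \<in> lbl ` set L" for x
  proof -
    obtain y where y: "y \<in> set L" "lbl x = lbl y"
      using x(2) by (rule imageE)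
    have "y \<noteq> x"
      using x(1) y(1) dist by auto
    moreover have "y = x \<or> y = mate x"
      by (rule wf_gauss_same_lbl[OF wf]) (simp_all add: x(1) y)
    ultimately show ?thesis
      using y(1) by blast
  qed
  show "mate x \<in> set M" if x: "x \<in> set M" "lbl x \<notin> lbl ` set L" for x
  proof -
    have "mate x \<notin> set L"
      using x(2) by (metis imageI lbl_mate)
    with mate[of x] x show ?thesis
      by blast
  qed
qed

section \<open>Inside and outside of the loop\<close>

lemma walk_no_turn:
  assumes "walk \<kappa> p w q" "\<And>x. x \<in> set w \<Longrightarrow> \<not> par \<kappa> (lbl x)"
  shows "turn q = turn p \<and> (\<forall>x\<in>set w. turn (inc \<kappa> x) = turn p)"
  using assms
proof (induction w arbitrary: p)
  case (Cons x w)
  have "turn q = turn (outc \<kappa> x) \<and> (\<forall>y\<in>set w. turn (inc \<kappa> y) = turn (outc \<kappa> x))"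
    using Cons.IH[of "outc \<kappa> x"] Cons.prems by simp
  moreover have "turn (outc \<kappa> x) = turn (inc \<kappa> x)"
    unfolding turn_outc using Cons.prems(2)[of x] by simp
  ultimately show ?case
    using Cons.prems(1) by simp
qed simp

lemma walk_straight:
  assumes "walk \<kappa> p w q" "\<And>x. x \<in> set w \<Longrightarrow> inc \<kappa> x = outc \<kappa> x"
  shows "q = p \<and> (\<forall>x\<in>set w. inc \<kappa> x = p)"
  using assms
proof (induction w arbitrary: p)
  case (Cons x w)
  have "walk \<kappa> (outc \<kappa> x) w q"
    using Cons.prems(1) by simp
  then have "q = outc \<kappa> x \<and> (\<forall>y\<in>set w. inc \<kappa> y = outc \<kappa> x)"
    by (rule Cons.IH) (rule Cons.prems(2), simp)
  moreover have "inc \<kappa> x = outc \<kappa> x"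
    using Cons.prems(2)[of x] by simp
  ultimately show ?case
    using Cons.prems(1) by simp
qed simp

text \<open>Crossing a strand that does not lie on the boundary changes no colour on either
  side.\<close>

lemma inc_eq_outc: "\<not> turn (inc \<kappa> (mate x)) \<Longrightarrow> \<not> par \<kappa> (lbl x) \<Longrightarrow> inc \<kappa> x = outc \<kappa> x"
  by (cases "eps x") (auto simp: inc_def outc_def par_def Let_def)

text \<open>The witnesses are read off a face colouring whose boundary is the loop.\<close>

lemma scan_exists:
  assumes st: "loop_state ov A L M"
  shows "\<exists>I \<sigma>. scan (lbl ` set L) I \<sigma> False M False"
proof -
  note facts = loop_state_facts[OF st]
  have "planar (A # L @ mate A # M)"
    using st by (simp add: loop_state_def knot_diagram_iff)
  then obtain \<kappa> where \<kappa>: "walk \<kappa> (False, False) (A # L @ mate A # M) (False, False)"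
      "\<forall>a\<in>lbl ` set (A # L @ mate A # M). par \<kappa> a \<longleftrightarrow> a \<in> {lbl A}"
    unfolding planar_def by blast
  have parA: "par \<kappa> (lbl A)"
    using \<kappa>(2) by simp
  have par: "\<not> par \<kappa> (lbl x)" if "x \<in> set L \<union> set M" for x
    using \<kappa>(2) facts(5)[OF that] that by auto
  have A: "inc \<kappa> A = (False, False)" and L: "walk \<kappa> (outc \<kappa> A) L (inc \<kappa> (mate A))"
    and M: "walk \<kappa> (outc \<kappa> (mate A)) M (False, False)"
    using \<kappa>(1) unfolding walk.simps walk_append by blast+
  have "turn (outc \<kappa> A)"
    unfolding turn_outc using A parA by simp
  then have "turn (inc \<kappa> (mate A))"
    using walk_no_turn[OF L] par by simp
  then have "\<not> turn (outc \<kappa> (mate A))"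
    unfolding turn_outc using parA by simp
  then have turnM: "\<not> turn (inc \<kappa> x)" if "x \<in> set M" for x
    using walk_no_turn[OF M] par that by auto
  have "outc \<kappa> (mate A) = (False, False)"
    using \<open>\<not> turn (outc \<kappa> (mate A))\<close> A by (cases "eps A") (auto simp: inc_def outc_def Let_def)
  with M have M: "walk \<kappa> (False, False) M (False, False)"
    by simp
  define l where "l = fst (outc \<kappa> A)"
  have l: "outc \<kappa> A = (l, \<not> l)"
    using \<open>turn (outc \<kappa> A)\<close> unfolding l_def by (cases "outc \<kappa> A") auto
  have "inc \<kappa> x = outc \<kappa> x" if "x \<in> set L" for x
    using that facts(1) turnM par by (intro inc_eq_outc) blast+
  then have incL: "inc \<kappa> x = (l, \<not> l)" if "x \<in> set L" for x
    using walk_straight[OF L] that unfolding l by blast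
  \<comment> \<open>Faces coloured True are the inside, to the left of the loop exactly if
    \<open>l\<close>. Entering a left inside means crossing the loop from right to left, so the loop
    letter has \<open>eps\<close> and its sign is \<open>ov\<close>; a right inside reverses this.
    For \<open>I\<close> any quadrant will do, as all four have one colour at a crossing off the
    loop.\<close>
  define \<sigma> where "\<sigma> = (ov = l)"
  define I where "I = {d. \<kappa> d True True}"
  have "scan (lbl ` set L) I \<sigma> b v False" if "walk \<kappa> (b, b) v (False, False)" "set v \<subseteq> set M" for b v
    using that
  proof (induction v arbitrary: b)
    case (Cons x v)
    have x: "inc \<kappa> x = (b, b)" "x \<in> set M" and v: "walk \<kappa> (outc \<kappa> x) v (False, False)" "set v \<subseteq> set M"
      using Cons.prems by simp_all
    show ?case
    proof (cases "lbl x \<in> lbl ` set L")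
      case True
      then have "mate x \<in> set L"
        using x(2) facts(3) by blast
      then have "inc \<kappa> (mate x) = (l, \<not> l)" "is_over x \<noteq> ov"
        using incL facts(2)[of "mate x"] unfolding is_over_mate by blast+
      moreover have "\<not> par \<kappa> (lbl x)"
        using par x(2) by blast
      ultimately have "outc \<kappa> x = (\<not> b, \<not> b) \<and> (is_pos x \<longleftrightarrow> b \<noteq> \<sigma>)"
        using x(1) unfolding \<sigma>_def
        by (cases "is_over x"; cases "is_pos x") (auto simp: inc_def outc_def par_def Let_def eps_def)
      with True Cons.IH[of "\<not> b"] v show ?thesis
        by simp
    next
      case False
      then have "\<not> turn (inc \<kappa> (mate x))" "\<not> par \<kappa> (lbl x)"
        using x(2) facts(4) turnM par by blast+
      then have "inc \<kappa> x = outc \<kappa> x" "lbl x \<in> I \<longleftrightarrow> b"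
        using x(1) unfolding I_def
        by (intro inc_eq_outc, simp_all) (cases "eps x"; auto simp: inc_def par_def Let_def)
      with x(1) False Cons.IH[of b] v show ?thesis
        by simp
    qed
  qed simp
  with M show ?thesis
    by blast
qed

text \<open>\<open>M\<close> starts outside, so each inside stretch begins with a passage through
  the loop, and the stretch containing \<open>x\<close> has an inside crossing right after it.
  Stepping by two letters skips stretches that enter and leave at once.\<close>

lemma scan_entry:
  assumes "scan Z I \<sigma> False M False" "x \<in> set M" "lbl x \<in> I - Z"
  shows "\<exists>M1 c d M2. M = M1 @ [c, d] @ M2 \<and> lbl c \<in> Z \<and> lbl d \<in> I - Z"
  using assms
proof (induction M rule: induct_list012)
  case (3 c d M)
  show ?case
  proof (cases "lbl c \<in> Z")
    case False
    then have "scan Z I \<sigma> False (d # M) False" "x \<in> set (d # M)"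
      using 3(3-5) by auto
    then obtain M1 c' d' M2 where "d # M = M1 @ [c', d'] @ M2" "lbl c' \<in> Z" "lbl d' \<in> I - Z"
      using 3(2)[OF _ _ 3(5)] by blast
    then have "c # d # M = (c # M1) @ [c', d'] @ M2" "lbl c' \<in> Z" "lbl d' \<in> I - Z"
      by simp_all
    then show ?thesis
      by blast
  next
    case c: True
    show ?thesis
    proof (cases "lbl d \<in> Z")
      case False
      then have "c # d # M = [] @ [c, d] @ M" "lbl d \<in> I - Z"
        using c 3(3) by simp_all
      with c show ?thesis
        by blast
    next
      case True
      then have "scan Z I \<sigma> False M False" "x \<in> set M"
        using c 3(3-5) by auto
      then obtain M1 c' d' M2 where "M = M1 @ [c', d'] @ M2" "lbl c' \<in> Z" "lbl d' \<in> I - Z"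
        using 3(1)[OF _ _ 3(5)] by blast
      then have "c # d # M = (c # d # M1) @ [c', d'] @ M2" "lbl c' \<in> Z" "lbl d' \<in> I - Z"
        by simp_all
      then show ?thesis
        by blast
    qed
  qed
qed auto

text \<open>With no crossing left inside, entering is followed at once by leaving, so passages
  through the loop come in adjacent pairs. Since the words around such a pair scan from outside to
  outside, the pair can be deleted.\<close>

lemma scan_arc:
  assumes "scan Z I \<sigma> False M False" "lbl ` set M \<inter> I \<subseteq> Z" "x \<in> set M" "lbl x \<in> Z"
  shows "\<exists>M1 c c' M2. M = M1 @ [c, c'] @ M2 \<and> lbl c \<in> Z \<and> lbl c' \<in> Z \<and> is_pos c = \<sigma> \<and> is_pos c' \<noteq> \<sigma> \<and>
    scan Z I \<sigma> False M1 False \<and> scan Z I \<sigma> False M2 False \<and> x \<in> {c, c'}"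
  using assms
proof (induction M rule: induct_list012)
  case (3 c d M)
  show ?case
  proof (cases "lbl c \<in> Z")
    case False
    then have "scan Z I \<sigma> False (d # M) False" "lbl ` set (d # M) \<inter> I \<subseteq> Z" "x \<in> set (d # M)"
      using 3(3-6) by auto
    then obtain M1 e e' M2 where "d # M = M1 @ [e, e'] @ M2" 
      and e: "lbl e \<in> Z" "lbl e' \<in> Z" "is_pos e = \<sigma>" "is_pos e' \<noteq> \<sigma>"
        "scan Z I \<sigma> False M1 False" "scan Z I \<sigma> False M2 False" "x \<in> {e, e'}"
      using 3(2)[OF _ _ _ 3(6)] by blast
    then have "c # d # M = (c # M1) @ [e, e'] @ M2" "scan Z I \<sigma> False (c # M1) False"
      using False 3(3) by simp_all
    with e show ?thesis
      by blast
  next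
    case c: True
    then have d: "lbl d \<in> Z"
      using 3(3,4) by (cases "lbl d \<in> Z") auto
    then have M: "scan Z I \<sigma> False M False" and pos: "is_pos c = \<sigma>" "is_pos d \<noteq> \<sigma>"
      using c 3(3) by auto
    show ?thesis
    proof (cases "x \<in> {c, d}")
      case True
      have "c # d # M = [] @ [c, d] @ M" "scan Z I \<sigma> False [] False"
        by simp_all
      with c d M pos True show ?thesis
        by blast
    next
      case False
      then have "lbl ` set M \<inter> I \<subseteq> Z" "x \<in> set M"
        using 3(4,5) by auto
      then obtain M1 e e' M2 where "M = M1 @ [e, e'] @ M2" 
        and e: "lbl e \<in> Z" "lbl e' \<in> Z" "is_pos e = \<sigma>" "is_pos e' \<noteq> \<sigma>"
          "scan Z I \<sigma> False M1 False" "scan Z I \<sigma> False M2 False" "x \<in> {e, e'}"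
        using 3(1)[OF M _ _ 3(6)] by blast
      then have "c # d # M = (c # d # M1) @ [e, e'] @ M2" "scan Z I \<sigma> False (c # d # M1) False"
        using c d pos by simp_all
      with e show ?thesis
        by blast
    qed
  qed
qed auto

text \<open>The cycle turning exactly at \<open>c\<close> and \<open>c'\<close> consists of the arc from \<open>c\<close> to \<open>c'\<close> and
the part \<open>L2\<close> of the loop cut off by it; no other arc inside the loop can cross it.\<close>

lemma arcs_noncrossing:
  assumes st: "loop_state ov A L M" and L: "L = L1 @ [k1] @ L2 @ [k2] @ L3"
    and M: "M = M1 @ [c, c'] @ M2" and k: "k1 = mate c \<and> k2 = mate c' \<or> k1 = mate c' \<and> k2 = mate c"
    and pos: "is_pos c = \<sigma>" "is_pos c' \<noteq> \<sigma>"
    and N: "M = N1 @ [e, e'] @ N2" and pos': "is_pos e = \<sigma>" "is_pos e' \<noteq> \<sigma>"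
    and eL: "mate e \<in> set L" "mate e' \<in> set L" and one: "mate e \<in> set L2 \<or> mate e' \<in> set L2"
  shows "mate e \<in> set L2 \<and> mate e' \<in> set L2"
proof -
  note facts = loop_state_facts[OF st]
  have wf: "wf_gauss (A # L @ mate A # M)"
    using st by (rule loop_state_wf)
  have dist: "distinct L" "distinct M" "set L \<inter> set M = {}"
    using wf_gauss_distinct[OF wf] by auto
  have cL: "mate c \<in> set L" "mate c' \<in> set L"
    using k L by auto
  have over: "is_over x \<noteq> ov" if "mate x \<in> set L" for x
    using facts(2)[OF that] unfolding is_over_mate by blast
  have ne: "e \<notin> {c, c'} \<and> e' \<notin> {c, c'}"
  proof -
    have "mate e \<notin> {mate c, mate c'} \<or> mate e' \<notin> {mate c, mate c'}"
      using one k dist(1) unfolding L by auto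
    then have ee: "e \<notin> {c, c'} \<or> e' \<notin> {c, c'}"
      by auto
    have "e = c \<longleftrightarrow> e' = c'"
    proof
      assume "e = c"
      then have "M1 @ c # c' # M2 = N1 @ c # e' # N2" "distinct (M1 @ c # c' # M2)"
        using M N dist(2) by simp_all
      then show "e' = c'"
        by (subst (asm) append_Cons_eq_iff) auto
    next
      assume "e' = c'"
      then have "(M1 @ [c]) @ c' # M2 = (N1 @ [e]) @ c' # N2" "distinct ((M1 @ [c]) @ c' # M2)"
        using M N dist(2) by simp_all
      then show "e = c"
        by (subst (asm) append_Cons_eq_iff) auto
    qed
    moreover have "e \<noteq> c'" "e' \<noteq> c"
      using pos pos' by blast+
    ultimately show ?thesis
      using ee by blast
  qed
  have "planar (A # L @ mate A # M)"
    using st by (simp add: loop_state_def knot_diagram_iff)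
  then obtain \<kappa> where \<kappa>: "walk \<kappa> (False, False) (A # L @ mate A # M) (False, False)"
      "\<forall>a\<in>lbl ` set (A # L @ mate A # M). par \<kappa> a \<longleftrightarrow> a \<in> {lbl c, lbl c'}"
    unfolding planar_def by blast
  have parc: "par \<kappa> (lbl c)" "par \<kappa> (lbl c')"
    using \<kappa>(2) unfolding M by simp_all
  have lblc: "x \<in> {c, c', mate c, mate c'}" if "x \<in> set L \<union> set M" "lbl x \<in> {lbl c, lbl c'}" for x
  proof -
    have "c \<in> set (A # L @ mate A # M)" "c' \<in> set (A # L @ mate A # M)" "x \<in> set (A # L @ mate A # M)"
      using that(1) unfolding M by auto
    then show ?thesis
      using wf_gauss_same_lbl[OF wf] that(2) by blast
  qed
  have par: "\<not> par \<kappa> (lbl x)" if "x \<in> set L \<union> set M" "x \<notin> {c, c', mate c, mate c'}" for x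
  proof -
    have "lbl x \<notin> {lbl c, lbl c'}"
      using lblc that by blast
    moreover have "lbl x \<in> lbl ` set (A # L @ mate A # M)"
      using that(1) by auto
    ultimately show ?thesis
      using \<kappa>(2) by blast
  qed
  have parA: "\<not> par \<kappa> (lbl A)"
  proof -
    have "lbl A \<notin> {lbl c, lbl c'}"
      using facts(5)[of c] facts(5)[of c'] unfolding M by auto
    then show ?thesis
      using \<kappa>(2) by simp
  qed
  have kk: "k1 \<noteq> k2" "{k1, k2} = {mate c, mate c'}"
    using k dist(1) unfolding L by auto
  have Lne: "x \<notin> {c, c', mate c, mate c'}" if "x \<in> set L1 \<union> set L2 \<union> set L3" for x
  proof -
    have "x \<notin> set M"
      using that dist(3) unfolding L by auto
    moreover have "x \<notin> {k1, k2}"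
      using that dist(1) unfolding L by auto
    ultimately show ?thesis
      using kk(2) unfolding M by auto
  qed
  have Mne: "x \<notin> {c, c', mate c, mate c'}" if "x \<in> set M1 \<union> set M2" for x
  proof -
    have "x \<notin> set L"
      using that dist(3) unfolding M by auto
    moreover have "x \<notin> {c, c'}"
      using that dist(2) unfolding M by auto
    ultimately show ?thesis
      using cL by auto
  qed
  have parL: "\<not> par \<kappa> (lbl x)" if "x \<in> set L1 \<union> set L2 \<union> set L3" for x
    by (rule par[OF _ Lne[OF that]]) (use that L in auto)
  have parM: "\<not> par \<kappa> (lbl x)" if "x \<in> set M1 \<union> set M2" for x
    by (rule par[OF _ Mne[OF that]]) (use that M in auto)
  have park: "par \<kappa> (lbl k1)" "par \<kappa> (lbl k2)"
    using k parc by auto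
  have A: "inc \<kappa> A = (False, False)" and
    wL1: "walk \<kappa> (outc \<kappa> A) L1 (inc \<kappa> k1)" and wL2: "walk \<kappa> (outc \<kappa> k1) L2 (inc \<kappa> k2)" and
    wL3: "walk \<kappa> (outc \<kappa> k2) L3 (inc \<kappa> (mate A))" and wM1: "walk \<kappa> (outc \<kappa> (mate A)) M1 (inc \<kappa> c)" and
    cc': "inc \<kappa> c' = outc \<kappa> c" and wM2: "walk \<kappa> (outc \<kappa> c') M2 (False, False)"
    using \<kappa>(1) unfolding L M walk.simps walk_append by blast+
  have turns: "\<not> turn (outc \<kappa> A)" "\<not> turn (inc \<kappa> k1)" "turn (outc \<kappa> k1)" "turn (inc \<kappa> k2)" "\<not> turn (outc \<kappa> k2)"
    "\<not> turn (outc \<kappa> (mate A))" "\<not> turn (inc \<kappa> c)" "\<not> turn (outc \<kappa> c')"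
  proof -
    show 1: "\<not> turn (outc \<kappa> A)"
      unfolding turn_outc using A parA by simp
    show 2: "\<not> turn (inc \<kappa> k1)"
      using walk_no_turn[OF wL1] parL 1 by blast
    show 3: "turn (outc \<kappa> k1)"
      unfolding turn_outc using 2 park by simp
    show 4: "turn (inc \<kappa> k2)"
      using walk_no_turn[OF wL2] parL 3 by blast
    show 5: "\<not> turn (outc \<kappa> k2)"
      unfolding turn_outc using 4 park by simp
    have "\<not> turn (inc \<kappa> (mate A))"
      using walk_no_turn[OF wL3] parL 5 by blast
    then show 6: "\<not> turn (outc \<kappa> (mate A))"
      unfolding turn_outc using parA by simp
    show 7: "\<not> turn (inc \<kappa> c)"
      using walk_no_turn[OF wM1] parM 6 by blast
    then have "turn (inc \<kappa> c')"
      unfolding cc' turn_outc using parc by simp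
    then show "\<not> turn (outc \<kappa> c')"
      unfolding turn_outc using parc by simp
  qed
  have turnM: "\<not> turn (inc \<kappa> x)" if "x \<in> set M1 \<union> set M2" for x
    using walk_no_turn[OF wM1] walk_no_turn[OF wM2] turns(6,8) parM that by blast
  have straight: "inc \<kappa> x = outc \<kappa> x" if x: "x \<in> set L1 \<union> set L2 \<union> set L3" for x
  proof (rule inc_eq_outc)
    have "mate x \<in> set M"
      using facts(1)[of x] x unfolding L by auto
    moreover have "mate x \<noteq> c" "mate x \<noteq> c'"
      using Lne[OF x] by auto
    ultimately show "\<not> turn (inc \<kappa> (mate x))"
      using turnM[of "mate x"] unfolding M by auto
  qed (rule parL[OF x])
  \<comment> \<open>The colour on the inner side of the loop: the inside lies to the left exactly if
    \<open>ov = \<sigma>\<close>, as in \<open>scan_exists\<close>.\<close>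
  define side where "side p = (if ov = \<sigma> then fst p else snd p)" for p :: "bool \<times> bool"
  have "side (outc \<kappa> (mate c)) \<noteq> side (inc \<kappa> (mate c))"
    using over[OF cL(1)] pos(1) parc(1) turns(7) unfolding side_def
    by (cases "is_over c"; cases "is_pos c"; simp add: inc_def outc_def par_def Let_def eps_def; blast)
  moreover have "side (outc \<kappa> (mate c')) \<noteq> side (inc \<kappa> (mate c'))"
    using over[OF cL(2)] pos(2) parc(2) turns(8) unfolding side_def
    by (cases "is_over c'"; cases "is_pos c'"; simp add: inc_def outc_def par_def Let_def eps_def; blast)
  ultimately have flip: "side (outc \<kappa> k1) \<noteq> side (inc \<kappa> k1)" "side (outc \<kappa> k2) \<noteq> side (inc \<kappa> k2)"
    using k by blast+
  have sL1: "inc \<kappa> k1 = outc \<kappa> A" "\<And>x. x \<in> set L1 \<Longrightarrow> inc \<kappa> x = outc \<kappa> A"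
    using walk_straight[OF wL1] straight by blast+
  have sL2: "inc \<kappa> k2 = outc \<kappa> k1" "\<And>x. x \<in> set L2 \<Longrightarrow> inc \<kappa> x = outc \<kappa> k1"
    using walk_straight[OF wL2] straight by blast+
  have sL3: "\<And>x. x \<in> set L3 \<Longrightarrow> inc \<kappa> x = outc \<kappa> k2"
    using walk_straight[OF wL3] straight by blast
  \<comment> \<open>The inner colour changes only at \<open>k1\<close> and \<open>k2\<close>, so it
    distinguishes \<open>L2\<close> from the rest of the loop.\<close>
  have in_L2: "x \<in> set L2 \<longleftrightarrow> side (inc \<kappa> x) \<noteq> side (outc \<kappa> A)" if "x \<in> set L" "x \<notin> {k1, k2}" for x
  proof -
    have "x \<in> set L1 \<union> set L3 \<or> x \<in> set L2" "x \<in> set L2 \<Longrightarrow> x \<notin> set L1 \<union> set L3"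
      using that dist(1) unfolding L by auto
    moreover have "side (outc \<kappa> k1) \<noteq> side (outc \<kappa> A)" "side (outc \<kappa> k2) = side (outc \<kappa> A)"
      using flip sL1(1) sL2(1) by auto
    ultimately show ?thesis
      using sL1(2) sL2(2) sL3 by (metis UnE)
  qed
  have eM: "e \<in> set M1 \<union> set M2" "e' \<in> set M1 \<union> set M2"
  proof -
    have "e \<in> set M" "e' \<in> set M"
      unfolding N by simp_all
    then show "e \<in> set M1 \<union> set M2" "e' \<in> set M1 \<union> set M2"
      using ne unfolding M by auto
  qed
  have ee': "inc \<kappa> e' = outc \<kappa> e"
    using \<kappa>(1) unfolding N walk.simps walk_append by blast
  have te: "\<not> turn (outc \<kappa> e)"
    unfolding turn_outc using turnM[OF eM(1)] parM[OF eM(1)] by blast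
  \<comment> \<open>The edge from \<open>e\<close> to \<open>e'\<close> is not on the boundary, so
    it has one colour on both sides. It touches the loop from inside at both ends, so the inner
    colours there agree.\<close>
  have "side (inc \<kappa> (mate e)) = fst (outc \<kappa> e)"
    using over[OF eL(1)] pos'(1) te unfolding side_def
    by (cases "is_over e"; cases "is_pos e"; simp add: inc_def outc_def Let_def eps_def)
  moreover have "side (inc \<kappa> (mate e')) = fst (inc \<kappa> e')"
    using over[OF eL(2)] pos'(2) turnM[OF eM(2)] unfolding side_def
    by (cases "is_over e'"; cases "is_pos e'"; simp add: inc_def outc_def Let_def eps_def)
  ultimately have "side (inc \<kappa> (mate e)) = side (inc \<kappa> (mate e'))"
    unfolding ee' by simp
  moreover have "mate e \<notin> {k1, k2}" "mate e' \<notin> {k1, k2}"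
    unfolding kk(2) using ne by auto
  ultimately show ?thesis
    using in_L2[OF eL(1)] in_L2[OF eL(2)] one by blast
qed

section \<open>Innermost arcs and the moves that shrink the loop\<close>

lemma split_two:
  assumes "x \<in> set w" "y \<in> set w" "x \<noteq> y"
  shows "\<exists>u a v b z. w = u @ [a] @ v @ [b] @ z \<and> (a = x \<and> b = y \<or> a = y \<and> b = x)"
proof -
  obtain p q where w: "w = p @ x # q"
    using assms(1) split_list by fast
  then consider "y \<in> set p" | "y \<in> set q"
    using assms(2,3) by auto
  then show ?thesis
  proof cases
    case 1
    then obtain r s where "p = r @ y # s"
      using split_list by fast
    then have "w = r @ [y] @ s @ [x] @ q"
      by (simp add: w)
    then show ?thesis
      by blast
  next
    case 2
    then obtain r s where "q = r @ y # s"
      using split_list by fast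
    then have "w = p @ [x] @ r @ [y] @ s"
      by (simp add: w)
    then show ?thesis
      by blast
  qed
qed

text \<open>An innermost arc has adjacent ends on the loop: a letter between them is the end of an
  arc whose other end, by \<open>arcs_noncrossing\<close>, also lies between, which gives a shorter
  gap.\<close>

lemma adjacent_arc:
  assumes st: "loop_state ov A L M" and scan: "scan (lbl ` set L) I \<sigma> False M False"
    and out: "lbl ` set M \<inter> I \<subseteq> lbl ` set L" and L: "L \<noteq> []"
  shows "\<exists>L1 k1 k2 L3 M1 c c' M2. L = L1 @ [k1, k2] @ L3 \<and> M = M1 @ [c, c'] @ M2 \<and>
    (k1 = mate c \<and> k2 = mate c' \<or> k1 = mate c' \<and> k2 = mate c) \<and> is_pos c = \<sigma> \<and> is_pos c' \<noteq> \<sigma> \<and>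
    scan (lbl ` set L) I \<sigma> False M1 False \<and> scan (lbl ` set L) I \<sigma> False M2 False" (is ?adj)
proof -
  note facts = loop_state_facts[OF st]
  define arc where "arc c c' \<longleftrightarrow> (\<exists>M1 M2. M = M1 @ [c, c'] @ M2 \<and>
    scan (lbl ` set L) I \<sigma> False M1 False \<and> scan (lbl ` set L) I \<sigma> False M2 False) \<and>
    is_pos c = \<sigma> \<and> is_pos c' \<noteq> \<sigma> \<and> mate c \<in> set L \<and> mate c' \<in> set L" for c c'
  have ex: "\<exists>c c'. arc c c' \<and> (x = mate c \<or> x = mate c')" if x: "x \<in> set L" for x
  proof -
    have "mate x \<in> set M" "lbl (mate x) \<in> lbl ` set L"
      using x facts(1) by simp_all
    then obtain M1 c c' M2 where c: "M = M1 @ [c, c'] @ M2" "lbl c \<in> lbl ` set L" "lbl c' \<in> lbl ` set L"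
      "is_pos c = \<sigma>" "is_pos c' \<noteq> \<sigma>" "scan (lbl ` set L) I \<sigma> False M1 False"
      "scan (lbl ` set L) I \<sigma> False M2 False" "mate x \<in> {c, c'}"
      using scan_arc[OF scan out] by blast
    have "c \<in> set M" "c' \<in> set M"
      unfolding c(1) by simp_all
    then have "mate c \<in> set L" "mate c' \<in> set L"
      using c(2,3) facts(3) by blast+
    then have "arc c c'"
      unfolding arc_def using c by blast
    moreover have "x = mate c \<or> x = mate c'"
      using c(8) by auto
    ultimately show ?thesis
      by blast
  qed
  have step: ?adj if "L = L1 @ [k1] @ L2 @ [k2] @ L3" "arc c c'"
      "k1 = mate c \<and> k2 = mate c' \<or> k1 = mate c' \<and> k2 = mate c" for L1 k1 L2 k2 L3 c c'
    using that
  proof (induction "length L2" arbitrary: L1 k1 L2 k2 L3 c c' rule: less_induct)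
    case less
    obtain M1 M2 where c: "M = M1 @ [c, c'] @ M2" "scan (lbl ` set L) I \<sigma> False M1 False"
      "scan (lbl ` set L) I \<sigma> False M2 False" "is_pos c = \<sigma>" "is_pos c' \<noteq> \<sigma>"
      using less.prems(2) unfolding arc_def by blast
    show ?case
    proof (cases "L2 = []")
      case True
      then have "L = L1 @ [k1, k2] @ L3"
        using less.prems(1) by simp
      with c less.prems(3) show ?thesis
        by blast
    next
      case False
      then obtain x where x: "x \<in> set L2"
        by (cases L2) auto
      then have "x \<in> set L"
        unfolding less.prems(1) by simp
      then obtain e e' where e: "arc e e'" "x = mate e \<or> x = mate e'"
        using ex by blast
      then obtain N1 N2 where e': "M = N1 @ [e, e'] @ N2" "is_pos e = \<sigma>" "is_pos e' \<noteq> \<sigma>"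
        "mate e \<in> set L" "mate e' \<in> set L"
        unfolding arc_def by blast
      have "mate e \<in> set L2 \<or> mate e' \<in> set L2"
        using e(2) x by blast
      then have "mate e \<in> set L2 \<and> mate e' \<in> set L2"
        by (rule arcs_noncrossing[OF st less.prems(1) c(1) less.prems(3) c(4,5) e'])
      moreover have "mate e \<noteq> mate e'"
        using e'(2,3) by (metis is_pos_mate)
      ultimately obtain u a v b z where "L2 = u @ [a] @ v @ [b] @ z"
        and ab: "a = mate e \<and> b = mate e' \<or> a = mate e' \<and> b = mate e"
        using split_two[of "mate e" L2 "mate e'"] by blast
      then have "length v < length L2" "L = (L1 @ [k1] @ u) @ [a] @ v @ [b] @ (z @ [k2] @ L3)"
        using less.prems(1) by simp_all
      then show ?thesis
        using less.hyps[of v "L1 @ [k1] @ u" a b "z @ [k2] @ L3" e e'] e(1) ab by blast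
    qed
  qed
  obtain x where "x \<in> set L"
    using L by (cases L) auto
  then obtain c c' where arc: "arc c c'"
    using ex by blast
  then have "mate c \<in> set L" "mate c' \<in> set L" "mate c \<noteq> mate c'"
    unfolding arc_def by (blast, blast, metis is_pos_mate)
  then obtain u a v b z where "L = u @ [a] @ v @ [b] @ z"
    "a = mate c \<and> b = mate c' \<or> a = mate c' \<and> b = mate c"
    using split_two[of "mate c" L "mate c'"] by blast
  then show ?thesis
    using step arc by blast
qed

lemma reidemeister_move_knot_diagram:
  "reidemeister_move w w' \<Longrightarrow> knot_diagram w" "reidemeister_move w w' \<Longrightarrow> knot_diagram w'"
  by (simp_all add: reidemeister_move_def)

text \<open>The arc and the loop bound a bigon whose corners have opposite signs, one being an entry
  and the other an exit. The filtered word is the invariant that identifies the final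
  diagram.\<close>

lemma remove_arc:
  assumes st: "loop_state ov A L M" and scan: "scan (lbl ` set L) I \<sigma> False M False"
    and out: "lbl ` set M \<inter> I \<subseteq> lbl ` set L" and L: "L \<noteq> []"
  shows "\<exists>L' M'. loop_state ov A L' M' \<and> reidemeister_move (A # L @ mate A # M) (A # L' @ mate A # M') \<and>
    scan (lbl ` set L') I \<sigma> False M' False \<and> lbl ` set M' \<inter> I \<subseteq> lbl ` set L' \<and> length L = length L' + 2 \<and>
    filter (\<lambda>x. lbl x \<notin> lbl ` set L') M' = filter (\<lambda>x. lbl x \<notin> lbl ` set L) M"
proof -
  note facts = loop_state_facts[OF st]
  have wf: "wf_gauss (A # L @ mate A # M)"
    using st by (rule loop_state_wf)
  have kd: "knot_diagram (A # L @ mate A # M)"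
    using st by (simp add: loop_state_def)
  obtain L1 k1 k2 L3 M1 c c' M2 where L: "L = L1 @ [k1, k2] @ L3" and M: "M = M1 @ [c, c'] @ M2"
    and k: "k1 = mate c \<and> k2 = mate c' \<or> k1 = mate c' \<and> k2 = mate c" and pos: "is_pos c = \<sigma>" "is_pos c' \<noteq> \<sigma>"
    and scans: "scan (lbl ` set L) I \<sigma> False M1 False" "scan (lbl ` set L) I \<sigma> False M2 False"
    using adjacent_arc[OF st scan out L] by (elim exE conjE) (rule that)
  have "is_over k1 = ov" "is_over k2 = ov"
    using facts(2) unfolding L by simp_all
  then have over: "is_over k2 = is_over k1"
    by simp
  have pos_k: "is_pos k2 \<longleftrightarrow> \<not> is_pos k1"
    using k pos by auto
  have z: "[c, c'] = [mate k1, mate k2] \<or> [c, c'] = [mate k2, mate k1]"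
    using k by auto
  have "reidemeister_move ((A # L1) @ [k1, k2] @ (L3 @ mate A # M1) @ [c, c'] @ M2) ((A # L1) @ (L3 @ mate A # M1) @ M2)"
    using kd unfolding L M by (intro R2_move[OF _ z over pos_k]) simp
  then have move: "reidemeister_move (A # L @ mate A # M) (A # (L1 @ L3) @ mate A # (M1 @ M2))"
    unfolding L M by simp
  have "\<forall>x\<in>set (L1 @ L3). is_over x = ov"
    using facts(2) unfolding L by simp
  with reidemeister_move_knot_diagram(2)[OF move] have st': "loop_state ov A (L1 @ L3) (M1 @ M2)"
    unfolding loop_state_def by blast
  have lbls: "lbl x \<notin> {lbl c, lbl c'}" if x: "x \<in> set (M1 @ M2)" for x
  proof
    assume "lbl x \<in> {lbl c, lbl c'}"
    moreover have "c \<in> set (A # L @ mate A # M)" "c' \<in> set (A # L @ mate A # M)" "x \<in> set (A # L @ mate A # M)"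
      using x unfolding M by auto
    ultimately have "x \<in> {c, c', mate c, mate c'}"
      using wf_gauss_same_lbl[OF wf] by blast
    moreover have "mate c \<in> set L" "mate c' \<in> set L"
      using k unfolding L by auto
    moreover have "x \<notin> set L" "x \<notin> {c, c'}"
      using wf_gauss_distinct[OF wf] x unfolding M by auto
    ultimately show False
      by auto
  qed
  have "lbl ` {k1, k2} = {lbl c, lbl c'}"
    using k by auto
  then have LZ: "lbl ` set L = lbl ` set (L1 @ L3) \<union> {lbl c, lbl c'}"
    unfolding L by auto
  have Z: "a \<in> lbl ` set L \<longleftrightarrow> a \<in> lbl ` set (L1 @ L3)" if "a \<in> lbl ` set (M1 @ M2)" for a
  proof -
    obtain x where x: "x \<in> set (M1 @ M2)" "a = lbl x"
      using \<open>a \<in> _\<close> by (rule imageE)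
    have "a \<notin> {lbl c, lbl c'}"
      unfolding x(2) by (rule lbls[OF x(1)])
    then show ?thesis
      unfolding LZ Un_iff by (simp only: simp_thms)
  qed
  have "scan (lbl ` set L) I \<sigma> False (M1 @ M2) False"
    using scans by auto
  then have "scan (lbl ` set (L1 @ L3)) I \<sigma> False (M1 @ M2) False"
    using scan_cong[of "M1 @ M2" "lbl ` set L" "lbl ` set (L1 @ L3)" I I] Z by blast
  moreover have "lbl ` set (M1 @ M2) \<inter> I \<subseteq> lbl ` set (L1 @ L3)"
  proof
    fix a assume a: "a \<in> lbl ` set (M1 @ M2) \<inter> I"
    then have "a \<in> lbl ` set M"
      unfolding M by auto
    with a out Z show "a \<in> lbl ` set (L1 @ L3)"
      by blast
  qed
  moreover have "filter (\<lambda>x. lbl x \<notin> lbl ` set (L1 @ L3)) (M1 @ M2) = filter (\<lambda>x. lbl x \<notin> lbl ` set L) M"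
  proof -
    have "filter (\<lambda>x. lbl x \<notin> lbl ` set (L1 @ L3)) (M1 @ M2) = filter (\<lambda>x. lbl x \<notin> lbl ` set L) (M1 @ M2)"
      using Z by (intro filter_cong refl) blast
    moreover have "lbl c \<in> lbl ` set L" "lbl c' \<in> lbl ` set L"
      unfolding LZ by blast+
    ultimately show ?thesis
      unfolding M by simp
  qed
  moreover have "length L = length (L1 @ L3) + 2"
    unfolding L by simp
  ultimately show ?thesis
    using st' move by blast
qed

text \<open>The first crossing met by a strand on entering the loop is pushed out. The two crossings
  gained lie on the loop, not inside it, so the inside crossings decrease by one.\<close>

lemma push_step:
  assumes st: "loop_state ov A L M" and scan: "scan (lbl ` set L) I \<sigma> False M False"
    and x: "x \<in> set M" "lbl x \<in> I - lbl ` set L"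
  shows "\<exists>L' M' I' w1. loop_state ov A L' M' \<and> reidemeister_move (A # L @ mate A # M) w1 \<and>
    reidemeister_move w1 (A # L' @ mate A # M') \<and> scan (lbl ` set L') I' \<sigma> False M' False \<and>
    card (lbl ` set M' \<inter> I' - lbl ` set L') < card (lbl ` set M \<inter> I - lbl ` set L) \<and>
    length L' = length L + 2 \<and>
    filter (\<lambda>x. lbl x \<notin> lbl ` set L') M' = filter (\<lambda>x. lbl x \<notin> lbl ` set L) M"
proof -
  note facts = loop_state_facts[OF st]
  let ?w = "A # L @ mate A # M"
  let ?Z = "lbl ` set L"
  have wf: "wf_gauss ?w"
    using st by (rule loop_state_wf)
  have kd: "knot_diagram ?w"
    using st by (simp add: loop_state_def)
  have distM: "distinct M"
    using wf_gauss_distinct[OF wf] by simp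
  obtain M1 c d M2 where M: "M = M1 @ [c, d] @ M2" and c: "lbl c \<in> ?Z" and d: "lbl d \<in> I - ?Z"
    using scan_entry[OF scan x] by blast
  have "c \<in> set M" "d \<in> set M"
    unfolding M by simp_all
  then have mc: "mate c \<in> set L" and md: "mate d \<in> set M"
    using c d facts(3,4) by blast+
  have cd: "lbl c \<noteq> lbl d"
    using c d by (metis DiffD2)
  then have "mate d \<noteq> c"
    by (metis lbl_mate)
  then have "mate d \<in> set M1 \<or> mate d \<in> set M2"
    using md unfolding M by auto
  then obtain f v1 v2 v3 where M: "M = v1 @ (if f then [c, d] else [mate d]) @ v2 @ (if f then [mate d] else [c, d]) @ v3"
  proof
    assume "mate d \<in> set M1"
    then obtain u v where "M1 = u @ mate d # v"
      using split_list by fast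
    then show thesis
      using that[of u False v M2] M by simp
  next
    assume "mate d \<in> set M2"
    then obtain u v where "M2 = u @ mate d # v"
      using split_list by fast
    then show thesis
      using that[of M1 True u v] M by simp
  qed
  define s1 s2 where "s1 = (if f then [c, d] else [mate d])" "s2 = (if f then [mate d] else [c, d])"
  note s = s1_s2_def
  have M: "M = v1 @ s1 @ v2 @ s2 @ v3"
    using M unfolding s .
  obtain L1 L2 where L: "L = L1 @ mate c # L2"
    using mc split_list by fast
  have "\<exists>a. a \<notin> lbl ` set ?w"
    by (intro ex_new_if_finite) (simp_all add: infinite_UNIV_nat)
  then obtain x where x: "x \<notin> lbl ` set ?w" ..
  have "\<exists>a. a \<notin> insert x (lbl ` set ?w)"
    by (intro ex_new_if_finite) (simp_all add: infinite_UNIV_nat)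
  then obtain y where y: "y \<notin> insert x (lbl ` set ?w)" ..
  define X :: letter where "X = (x, \<not> is_over c, \<not> is_pos c)"
  define Y :: letter where "Y = (y, \<not> is_over c, is_pos c)"
  have XY: "lbl X = x" "lbl Y = y" "is_over X = is_over (mate c)" "is_over Y = is_over (mate c)"
    "is_pos X \<longleftrightarrow> \<not> is_pos (mate c)" "is_pos Y = is_pos (mate c)"
    by (simp_all add: X_def Y_def lbl_def is_over_def is_pos_def mate_def)
  define s1' where "s1' = (if f then [d, c] else [mate X, mate d, mate Y])"
  define s2' where "s2' = (if f then [mate X, mate d, mate Y] else [d, c])"
  define N where "N = (if eps (mate c) \<noteq> eps d then [X, mate c, Y] else [Y, mate c, X])"
  define L' where "L' = L1 @ N @ L2"
  define M' where "M' = v1 @ s1' @ v2 @ s2' @ v3"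
  define I' where "I' = I - {lbl d}"
  let ?Z' = "lbl ` set L'"
  have w_eq: "?w = (A # L1) @ [mate c] @ (L2 @ mate A # v1) @ s1 @ v2 @ s2 @ v3"
    unfolding L M by simp
  have "\<exists>w1. reidemeister_move ?w w1 \<and> reidemeister_move w1 (A # L' @ mate A # M')"
  proof -
    have "\<exists>w1. reidemeister_move ((A # L1) @ [mate c] @ (L2 @ mate A # v1) @ s1 @ v2 @ s2 @ v3) w1 \<and>
        reidemeister_move w1 ((A # L1) @ N @ (L2 @ mate A # v1) @ s1' @ v2 @ s2' @ v3)"
      using push_move[where C = "mate c" and D = d and X = X and Y = Y and f = f and ?u0.0 = "A # L1"
          and ?u1.0 = "L2 @ mate A # v1" and ?u2.0 = v2 and ?u3.0 = v3, unfolded mate_mate, folded s N_def s1'_def s2'_def,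
          folded w_eq] kd cd x y XY unfolding lbl_mate w_eq[symmetric] by simp
    then show ?thesis
      unfolding w_eq L'_def M'_def by simp
  qed
  then obtain w1 where moves: "reidemeister_move ?w w1" "reidemeister_move w1 (A # L' @ mate A # M')"
    by blast
  have "is_over (mate c) = ov"
    using facts(2)[OF mc] .
  then have "\<forall>z\<in>set L'. is_over z = ov"
    using facts(2) XY(3,4) unfolding L'_def N_def L by auto
  with reidemeister_move_knot_diagram(2)[OF moves(2)] have st': "loop_state ov A L' M'"
    unfolding loop_state_def by blast
  have setN: "set N = {X, mate c, Y}"
    unfolding N_def by auto
  then have Z': "?Z' = ?Z \<union> {x, y}"
    unfolding L'_def L using XY(1,2) by auto
  have xyM: "x \<notin> lbl ` set M" "y \<notin> lbl ` set M"
    using x y by (simp_all add: image_Un)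
  have sets: "set s1 \<union> set s2 = {c, d, mate d}" "set s1' \<union> set s2' = {c, d, mate d, mate X, mate Y}"
    unfolding s s1'_def s2'_def by auto
  have setM: "set M = {c, d, mate d} \<union> set (v1 @ v2 @ v3)"
    unfolding M using sets(1) by auto
  have "set M' = (set s1' \<union> set s2') \<union> set (v1 @ v2 @ v3)"
    unfolding M'_def by auto
  then have lblM': "lbl ` set M' = lbl ` set M \<union> {x, y}"
    unfolding sets setM using XY(1,2) by auto
  have v: "(lbl z \<in> ?Z \<longleftrightarrow> lbl z \<in> ?Z') \<and> (lbl z \<in> I \<longleftrightarrow> lbl z \<in> I')" if z: "z \<in> set (v1 @ v2 @ v3)" for z
  proof -
    have "z \<in> set M"
      using z setM by blast
    moreover have "z \<noteq> d" "z \<noteq> mate d"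
      using z distM unfolding M s by (cases f; auto)+
    ultimately have "lbl z \<noteq> lbl d"
      using wf_gauss_same_lbl[OF wf, of d z] \<open>d \<in> set M\<close> by auto
    moreover have "lbl z \<in> lbl ` set M"
      using \<open>z \<in> set M\<close> by blast
    ultimately show ?thesis
      using xyM unfolding Z' I'_def by blast
  qed
  have v_scan: "scan ?Z' I' \<sigma> b u b'" if "scan ?Z I \<sigma> b u b'" "set u \<subseteq> set (v1 @ v2 @ v3)" for b u b'
  proof -
    have "(a \<in> ?Z \<longleftrightarrow> a \<in> ?Z') \<and> (a \<in> I \<longleftrightarrow> a \<in> I')" if "a \<in> lbl ` set u" for a
    proof -
      obtain z where z: "z \<in> set u" "a = lbl z"
        using \<open>a \<in> _\<close> by (rule imageE)
      show ?thesis
        unfolding z(2) by (rule v[OF subsetD[OF \<open>set u \<subseteq> _\<close> z(1)]])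
    qed
    then show ?thesis
      using scan_cong[of u ?Z ?Z' I I' \<sigma> b b'] that(1) by blast
  qed
  obtain b1 b2 b3 b4 where b: "scan ?Z I \<sigma> False v1 b1" "scan ?Z I \<sigma> b1 s1 b2" "scan ?Z I \<sigma> b2 v2 b3"
    "scan ?Z I \<sigma> b3 s2 b4" "scan ?Z I \<sigma> b4 v3 False"
    using scan unfolding M scan_append by blast
  have pos_c: "is_pos c = \<sigma>"
    using b(2,4) c d unfolding s by (cases f) auto
  have in_Z': "lbl c \<in> ?Z'" "lbl X \<in> ?Z'" "lbl Y \<in> ?Z'" and not_Z': "lbl d \<notin> ?Z'"
  proof -
    show "lbl c \<in> ?Z'" "lbl X \<in> ?Z'" "lbl Y \<in> ?Z'"
      unfolding Z' using c XY(1,2) by blast+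
    show "lbl d \<notin> ?Z'"
      unfolding Z' using d xyM \<open>d \<in> set M\<close> by blast
  qed
  have scan_dc: "scan ?Z' I' \<sigma> b [d, c] b'" if "scan ?Z I \<sigma> b [c, d] b'" for b b'
    using that c d in_Z' not_Z' pos_c by (simp add: I'_def) blast
  \<comment> \<open>The crossing \<open>d\<close> was inside, so the strand through
    \<open>mate d\<close> was inside there; now it leaves at \<open>X\<close>, passes
    \<open>d\<close> outside and enters again at \<open>Y\<close>.\<close>
  have scan_XY: "scan ?Z' I' \<sigma> b [mate X, mate d, mate Y] b'" if "scan ?Z I \<sigma> b [mate d] b'" for b b'
    using that d in_Z' not_Z' pos_c XY(5,6) by (cases b) (simp_all add: I'_def)
  have "scan ?Z' I' \<sigma> b1 s1' b2" "scan ?Z' I' \<sigma> b3 s2' b4"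
    using b(2,4) scan_dc scan_XY unfolding s s1'_def s2'_def by (cases f; simp only: if_True if_False)+
  moreover have "scan ?Z' I' \<sigma> False v1 b1" "scan ?Z' I' \<sigma> b2 v2 b3" "scan ?Z' I' \<sigma> b4 v3 False"
    using b(1,3,5) by (auto intro: v_scan)
  ultimately have "scan ?Z' I' \<sigma> False M' False"
    unfolding M'_def scan_append by blast
  moreover have "card (lbl ` set M' \<inter> I' - ?Z') < card (lbl ` set M \<inter> I - ?Z)"
  proof (rule psubset_card_mono)
    have "lbl ` set M' \<inter> I' - ?Z' = (lbl ` set M \<inter> I - ?Z) - {lbl d}"
      unfolding lblM' Z' I'_def using xyM by blast
    moreover have "lbl d \<in> lbl ` set M \<inter> I - ?Z"
      using d \<open>d \<in> set M\<close> by blast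
    moreover have "B - {a} \<subset> B" if "a \<in> B" for a and B :: "nat set"
      using that by blast
    ultimately show "lbl ` set M' \<inter> I' - ?Z' \<subset> lbl ` set M \<inter> I - ?Z"
      by (simp only:)
  qed simp
  moreover have "length L' = length L + 2"
    unfolding L'_def L N_def by simp
  moreover have "filter (\<lambda>z. lbl z \<notin> ?Z') M' = filter (\<lambda>z. lbl z \<notin> ?Z) M"
  proof -
    have "filter (\<lambda>z. lbl z \<notin> ?Z') u = filter (\<lambda>z. lbl z \<notin> ?Z) u" if "set u \<subseteq> set (v1 @ v2 @ v3)" for u
    proof (intro filter_cong refl)
      fix z assume "z \<in> set u"
      then show "lbl z \<notin> ?Z' \<longleftrightarrow> lbl z \<notin> ?Z"
        using v[OF subsetD[OF that]] by simp
    qed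
    then have "filter (\<lambda>z. lbl z \<notin> ?Z') v1 = filter (\<lambda>z. lbl z \<notin> ?Z) v1"
      "filter (\<lambda>z. lbl z \<notin> ?Z') v2 = filter (\<lambda>z. lbl z \<notin> ?Z) v2"
      "filter (\<lambda>z. lbl z \<notin> ?Z') v3 = filter (\<lambda>z. lbl z \<notin> ?Z) v3"
      by (simp_all add: le_supI1 le_supI2)
    moreover have "filter (\<lambda>z. lbl z \<notin> ?Z') s1' = filter (\<lambda>z. lbl z \<notin> ?Z) s1"
      "filter (\<lambda>z. lbl z \<notin> ?Z') s2' = filter (\<lambda>z. lbl z \<notin> ?Z) s2"
      using in_Z' not_Z' c d unfolding s s1'_def s2'_def by (cases f; simp)+
    ultimately show ?thesis
      unfolding M M'_def filter_append by (simp only:)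
  qed
  ultimately show ?thesis
    using st' moves by blast
qed

text \<open>Each R2 move takes two letters off \<open>L\<close>, and one R1 move removes
  \<open>A\<close>. Doubling the count avoids halving the length.\<close>

lemma sweep_empty:
  assumes "loop_state ov A L M" "scan (lbl ` set L) I \<sigma> False M False" "lbl ` set M \<inter> I \<subseteq> lbl ` set L"
  shows "\<exists>n. 2 * n \<le> length L + 2 \<and>
    (reidemeister_move ^^ n) (A # L @ mate A # M) (filter (\<lambda>x. lbl x \<notin> lbl ` set L) M)"
  using assms
proof (induction "length L" arbitrary: L M rule: less_induct)
  case less
  show ?case
  proof (cases "L = []")
    case True
    have "reidemeister_move (A # mate A # M) M"
      using less.prems(1) True by (intro R1_move) (simp add: loop_state_def)
    with True show ?thesis
      by (intro exI[of _ 1]) (simp add: relcompp_apply)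
  next
    case False
    obtain L' M' where step: "loop_state ov A L' M'" "reidemeister_move (A # L @ mate A # M) (A # L' @ mate A # M')"
      "scan (lbl ` set L') I \<sigma> False M' False" "lbl ` set M' \<inter> I \<subseteq> lbl ` set L'" "length L = length L' + 2"
      "filter (\<lambda>x. lbl x \<notin> lbl ` set L') M' = filter (\<lambda>x. lbl x \<notin> lbl ` set L) M"
      using remove_arc[OF less.prems False] by blast
    then obtain n where n: "2 * n \<le> length L' + 2"
      "(reidemeister_move ^^ n) (A # L' @ mate A # M') (filter (\<lambda>x. lbl x \<notin> lbl ` set L') M')"
      using less.hyps[of L' M'] by auto
    have "(reidemeister_move ^^ Suc n) (A # L @ mate A # M) (filter (\<lambda>x. lbl x \<notin> lbl ` set L) M)"
      using relpowp_Suc_I2[of reidemeister_move, OF step(2) n(2)] unfolding step(6) .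
    with n(1) step(5) show ?thesis
      by (intro exI[of _ "Suc n"]) simp
  qed
qed

text \<open>An inside crossing costs two moves for its push and one later R2 move for the two
  letters added to \<open>L\<close>: three moves, 6 in the doubled count.\<close>

lemma sweep:
  assumes "loop_state ov A L M" "scan (lbl ` set L) I \<sigma> False M False"
  shows "\<exists>n. 2 * n \<le> 6 * card (lbl ` set M \<inter> I - lbl ` set L) + length L + 2 \<and>
    (reidemeister_move ^^ n) (A # L @ mate A # M) (filter (\<lambda>x. lbl x \<notin> lbl ` set L) M)"
  using assms
proof (induction "card (lbl ` set M \<inter> I - lbl ` set L)" arbitrary: L M I rule: less_induct)
  case less
  show ?case
  proof (cases "lbl ` set M \<inter> I \<subseteq> lbl ` set L")
    case True
    from sweep_empty[OF less.prems True] obtain n where "2 * n \<le> length L + 2"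
      "(reidemeister_move ^^ n) (A # L @ mate A # M) (filter (\<lambda>x. lbl x \<notin> lbl ` set L) M)"
      by blast
    then show ?thesis
      by (intro exI[of _ n]) simp
  next
    case False
    then obtain x where x: "x \<in> set M" "lbl x \<in> I - lbl ` set L"
      by blast
    obtain L' M' I' w1 where step: "loop_state ov A L' M'"
      and moves: "reidemeister_move (A # L @ mate A # M) w1" "reidemeister_move w1 (A # L' @ mate A # M')"
      and step': "scan (lbl ` set L') I' \<sigma> False M' False"
      "card (lbl ` set M' \<inter> I' - lbl ` set L') < card (lbl ` set M \<inter> I - lbl ` set L)"
      "length L' = length L + 2"
      "filter (\<lambda>x. lbl x \<notin> lbl ` set L') M' = filter (\<lambda>x. lbl x \<notin> lbl ` set L) M"
      using push_step[OF less.prems x] by blast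
    obtain n where n: "2 * n \<le> 6 * card (lbl ` set M' \<inter> I' - lbl ` set L') + length L' + 2"
      "(reidemeister_move ^^ n) (A # L' @ mate A # M') (filter (\<lambda>x. lbl x \<notin> lbl ` set L') M')"
      using less.hyps[OF step'(2) step step'(1)] by blast
    have "(reidemeister_move ^^ Suc (Suc n)) (A # L @ mate A # M) (filter (\<lambda>x. lbl x \<notin> lbl ` set L) M)"
      using relpowp_Suc_I2[of reidemeister_move, OF moves(1) relpowp_Suc_I2[of reidemeister_move, OF moves(2) n(2)]] unfolding step'(4) .
    moreover have "2 * Suc (Suc n) \<le> 6 * card (lbl ` set M \<inter> I - lbl ` set L) + length L + 2"
      using n(1) Suc_leI[OF step'(2)] step'(3) by simp
    ultimately show ?thesis
      by blast
  qed
qed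

lemma shrink_loop:
  assumes st: "loop_state ov A L M"
  shows "\<exists>n \<le> 7 * crossings (A # L @ mate A # M) + 1.
    (reidemeister_move ^^ n) (A # L @ mate A # M) (filter (\<lambda>x. lbl x \<notin> lbl ` set L) M)"
proof -
  let ?w = "A # L @ mate A # M"
  obtain I \<sigma> where "scan (lbl ` set L) I \<sigma> False M False"
    using scan_exists[OF st] by blast
  then obtain n where n: "2 * n \<le> 6 * card (lbl ` set M \<inter> I - lbl ` set L) + length L + 2"
    "(reidemeister_move ^^ n) ?w (filter (\<lambda>x. lbl x \<notin> lbl ` set L) M)"
    using sweep[OF st] by blast
  have wf: "wf_gauss ?w"
    using st by (rule loop_state_wf)
  have "card (lbl ` set M \<inter> I - lbl ` set L) \<le> card (lbl ` set ?w)"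
    by (intro card_mono) auto
  moreover have "length L \<le> 2 * crossings ?w"
    using wf_gauss_length[OF wf] unfolding crossings_wf[OF wf] by simp
  ultimately have "n \<le> 7 * crossings ?w + 1"
    using n(1) unfolding crossings_wf[OF wf] by linarith
  with n(2) show ?thesis
    by blast
qed

section \<open>Change of base point and induction over the loops\<close>

lemma same_diagram_trans_swap: "same_diagram (u @ v) w \<Longrightarrow> same_diagram (v @ u) w"
proof -
  assume "same_diagram (u @ v) w"
  then obtain k f where f: "inj_on f (lbl ` set (u @ v))" "w = map (\<lambda>(a, ov, s). (f a, ov, s)) (rotate k (u @ v))"
    unfolding same_diagram_def by blast
  have "rotate k (u @ v) = rotate (k + length v) (v @ u)"
    by (simp flip: rotate_rotate add: rotate_append)
  with f show ?thesis
    unfolding same_diagram_def set_append Un_commute[of "set v"] by metis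
qed

text \<open>A rotation of the start is absorbed by the \<open>same_diagram\<close> inside the first
  move; without any move both words are empty.\<close>

lemma relpowp_move_swap:
  assumes "(reidemeister_move ^^ n) (u @ v) []"
  shows "(reidemeister_move ^^ n) (v @ u) []"
proof (cases n)
  case 0
  with assms show ?thesis
    by simp
next
  case (Suc m)
  then obtain w where w: "reidemeister_move (u @ v) w" "(reidemeister_move ^^ m) w []"
    using assms relpowp_Suc_D2 by metis
  then have "reidemeister_move (v @ u) w"
    unfolding reidemeister_move_def using same_diagram_trans_swap knot_diagram_rotate by blast
  with w(2) show ?thesis
    unfolding Suc by (intro relpowp_Suc_I2)
qed

lemma relpowp_move_knot_diagram:
  "(reidemeister_move ^^ n) w w' \<Longrightarrow> knot_diagram w \<Longrightarrow> knot_diagram w'"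
  by (cases n) (auto dest: reidemeister_move_knot_diagram(2))

text \<open>The shortest prefix that repeats a label ends at \<open>mate A\<close>. The labels
  before that are distinct, so each crossing on the loop is met there for the first time and
  monotonicity puts it on level \<open>ov\<close>.\<close>

lemma first_loop:
  assumes wf: "wf_gauss w" and w: "w \<noteq> []"
    and mono: "sorted_wrt (\<lambda>x y. lbl x = lbl y \<longrightarrow> is_over x = ov) w"
  shows "\<exists>P A L Q. w = P @ A # L @ mate A # Q \<and> (\<forall>x\<in>set L. is_over x = ov)"
proof -
  have "\<not> distinct (map lbl w)"
  proof
    assume dist: "distinct (map lbl w)"
    have "hd w \<in> set w" "mate (hd w) \<in> set w"
      using w wf_gauss_mate[OF wf] by simp_all
    then have "mate (hd w) = hd w"
      using dist unfolding distinct_map by (intro inj_onD[of lbl "set w"]) simp_all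
    then show False
      by simp
  qed
  then obtain xs b ys where xs: "map lbl w = xs @ b # ys" "b \<in> set xs" "distinct xs"
    unfolding not_distinct_conv_prefix by blast
  obtain p B Q where p: "w = p @ B # Q" "map lbl p = xs" "lbl B = b"
    using xs(1) unfolding map_eq_append_conv map_eq_Cons_conv by blast
  obtain A where A: "A \<in> set p" "lbl A = b"
    using xs(2) p(2) by auto
  obtain P L where PL: "p = P @ A # L"
    using A(1) split_list by fast
  have dist: "distinct w"
    using wf by (rule wf_gauss_distinct)
  have "B = A \<or> B = mate A"
    using wf_gauss_same_lbl[OF wf, of A B] A p by simp
  moreover have "B \<noteq> A"
    using dist A(1) unfolding p(1) by auto
  ultimately have B: "B = mate A"
    by blast
  have "is_over x = ov" if x: "x \<in> set L" for x
  proof -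
    have "x \<in> set p"
      using x PL by simp
    have "mate x \<in> set w"
      using wf_gauss_mate[OF wf, of x] x unfolding p(1) PL by simp
    moreover have "mate x \<notin> set p"
    proof
      assume "mate x \<in> set p"
      then have "mate x = x"
        using xs(3) \<open>x \<in> set p\<close> unfolding p(2)[symmetric] distinct_map
        by (intro inj_onD[of lbl "set p"]) simp_all
      then show False
        by simp
    qed
    ultimately have "mate x \<in> set (B # Q)"
      unfolding p(1) by simp
    then show ?thesis
      using mono \<open>x \<in> set p\<close> lbl_mate unfolding p(1) sorted_wrt_append by metis
  qed
  moreover have "w = P @ A # L @ mate A # Q"
    using p(1) PL B by simp
  ultimately show ?thesis
    by blast
qed

text \<open>\<open>ov\<close> treats both cases at once: True is descending, False
  ascending.\<close>

lemma monotone_unknot: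
  assumes "knot_diagram w" "sorted_wrt (\<lambda>x y. lbl x = lbl y \<longrightarrow> is_over x = ov) w"
  shows "\<exists>n \<le> (7 * crossings w + 1) * crossings w. (reidemeister_move ^^ n) w []"
  using assms
proof (induction "length w" arbitrary: w rule: less_induct)
  case less
  show ?case
  proof (cases "w = []")
    case True
    then show ?thesis
      by (intro exI[of _ 0]) simp
  next
    case False
    have wf: "wf_gauss w"
      using less.prems(1) by (simp add: knot_diagram_def)
    obtain P A L Q where w: "w = P @ A # L @ mate A # Q" and over: "\<forall>x\<in>set L. is_over x = ov"
      using first_loop[OF wf False less.prems(2)] by blast
    let ?w0 = "A # L @ mate A # (Q @ P)"
    let ?f = "filter (\<lambda>x. lbl x \<notin> lbl ` set L)"
    have "knot_diagram ((A # L @ mate A # Q) @ P)"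
      using less.prems(1) unfolding w by (rule knot_diagram_rotate)
    then have kd0: "knot_diagram ?w0"
      by simp
    with over have "loop_state ov A L (Q @ P)"
      unfolding loop_state_def by blast
    then obtain n where n: "n \<le> 7 * crossings ?w0 + 1" "(reidemeister_move ^^ n) ?w0 (?f (Q @ P))"
      using shrink_loop by blast
    have "crossings ?w0 = crossings w"
      by (simp add: crossings_def w ac_simps)
    \<comment> \<open>The loop was removed with the base point at \<open>A\<close>. Back at the old
      base point the remainder \<open>?f P @ ?f Q\<close> is a subword of \<open>w\<close>, hence
      monotone.\<close>
    have "knot_diagram (?f Q @ ?f P)"
      using relpowp_move_knot_diagram[OF n(2) kd0] by simp
    then have kd1: "knot_diagram (?f P @ ?f Q)"
      by (rule knot_diagram_rotate)
    have len: "length (?f P @ ?f Q) + 2 \<le> length w"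
      using length_filter_le[of _ P] length_filter_le[of _ Q] unfolding w by (simp add: add_mono le_SucI trans_le_add2)
    have "sorted_wrt (\<lambda>x y. lbl x = lbl y \<longrightarrow> is_over x = ov) (P @ Q)"
      using less.prems(2) unfolding w by (simp add: sorted_wrt_append) blast
    then have "sorted_wrt (\<lambda>x y. lbl x = lbl y \<longrightarrow> is_over x = ov) (?f P @ ?f Q)"
      using sorted_wrt_filter by fastforce
    then obtain m where m: "m \<le> (7 * crossings (?f P @ ?f Q) + 1) * crossings (?f P @ ?f Q)"
      "(reidemeister_move ^^ m) (?f P @ ?f Q) []"
      using less.hyps[of "?f P @ ?f Q"] len kd1 by auto
    have "(reidemeister_move ^^ (n + m)) ?w0 []"
      using n(2) relpowp_move_swap[OF m(2)] by (auto simp: relpowp_add)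
    then have "(reidemeister_move ^^ (n + m)) w []"
      using relpowp_move_swap[of "n + m" "A # L @ mate A # Q" P] unfolding w by simp
    moreover have "n + m \<le> (7 * crossings w + 1) * crossings w"
    proof -
      have c: "crossings (?f P @ ?f Q) + 1 \<le> crossings w"
        using len unfolding crossings_def by linarith
      then obtain k where k: "crossings w = Suc k"
        by (cases "crossings w") auto
      \<comment> \<open>At least the crossing \<open>A\<close> is gone, so the remainder costs at
        most (7 C + 1) (C - 1), which leaves 7 C + 1 for this loop.\<close>
      have "m \<le> (7 * crossings w + 1) * k"
        using c k by (intro order.trans[OF m(1)] mult_mono) auto
      then show ?thesis
        using n(1) \<open>crossings ?w0 = _\<close> unfolding k by simp
    qed
    ultimately show ?thesis
      by blast
  qed
qed

theorem theorem4p3: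
  fixes w :: gauss
  assumes "knot_diagram w"
    and "\<exists>k. ascending (rotate k w) \<or> descending (rotate k w)"
  shows "\<exists>n \<le> (7 * crossings w + 1) * crossings w. (reidemeister_move ^^ n) w []"
proof -
  obtain k where k: "ascending (rotate k w) \<or> descending (rotate k w)"
    using assms(2) by blast
  define u v where "u = take (k mod length w) w" "v = drop (k mod length w) w"
  have w: "w = u @ v" and rot: "rotate k w = v @ u"
    by (simp_all add: u_v_def rotate_drop_take)
  obtain ov where "sorted_wrt (\<lambda>x y. lbl x = lbl y \<longrightarrow> is_over x = ov) (v @ u)"
    using k unfolding rot ascending_def descending_def sorted_wrt_iff_nth_less by metis
  moreover have "knot_diagram (v @ u)"
    using assms(1) unfolding w by (rule knot_diagram_rotate)
  ultimately obtain n where n: "n \<le> (7 * crossings (v @ u) + 1) * crossings (v @ u)"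
    "(reidemeister_move ^^ n) (v @ u) []"
    using monotone_unknot by blast
  have "crossings (v @ u) = crossings (u @ v)"
    by (simp add: crossings_def)
  then show ?thesis
    unfolding w using n(1) relpowp_move_swap[OF n(2)] by (intro exI[of _ n]) simp
qed

end
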